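(* Let $A=(c_{ij}x^{\alpha_{ij}})$ be a squarefree multigraded $s\times l$ matrix over $R=\Bbbk[x_1,\ldots,x_n]$, $T=(\gamma_1,\ldots,\gamma_l,\beta_1,\ldots,\beta_s)$ a squarefree solution of $E_A$, $M_A=\mathrm{Coker}\,\phi_T$, and $\alpha\in\mathbb Z^n$. Let $(L_i^\alpha)^\bullet=C^\bullet(\Delta_i^\alpha)$ and $l_i^-=|\sigma_{\alpha_i^-}|-|\sigma_{\alpha_1^-}|$ for $i\in[s]$. For each $r\in\mathbb Z$ let $$(L^\alpha)^r=\bigoplus_{i=1}^s(L_i^\alpha)^{r-l_i^-},$$ and let $d^r:(L^\alpha)^r\to(L^\alpha)^{r+1}$ be the $\Bbbk$-linear map such that, for $\tau\in\Delta_i^\alpha$ with $|\tau|=r+1-l_i^-$, $$\tau^*\mapsto\sum_{h\in V_{\tau,\Delta_i^\alpha,1}}\mathrm{sgn}[h,\tau h]\,(\tau h)^*+\sum_{h\in V_{\tau,\Delta_i^\alpha,2}}\mathrm{sgn}[h,\tau h]\sum_{j<i}r_{i,j,\alpha_i^++\underline{\tau h\sigma_{\alpha_i^-}}}\ \frac{t(\sigma_{\alpha_i^-},\tau h\sigma_{\alpha_i^-})}{t(\sigma_{\alpha_j^-},\tau h\sigma_{\alpha_i^-})}\,\big(\tau h\sigma_{\alpha_i^-}\setminus\sigma_{\alpha_j^-}\big)^*,$$ where terms with coefficient $r_{i,j,\cdot}=0$ are omitted and $(\tau h\sigma_{\alpha_i^-}\setminus\sigma_{\alpha_j^-})^*$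 is taken in $C^\bullet(\Delta_j^\alpha)$. Then $((L^\alpha)^\bullet,d^\bullet)$ is a cochain complex and, for every $i$, $$\dim_\Bbbk H^i_{\mathfrak m}(M_A)_\alpha=\dim_\Bbbk H^{\,i-|\sigma_{\alpha_1^-}|-1}((L^\alpha)^\bullet).$$
   Context: $\Bbbk$ is a field of characteristic $0$, $R=\Bbbk[x_1,\ldots,x_n]$, $\mathfrak m=(x_1,\ldots,x_n)$, $H^i_{\mathfrak m}$ is local cohomology, $[t]=\{1,\ldots,t\}$. For $\alpha=(a_i)\in\mathbb Z^n$, $x^\alpha=\prod x_i^{a_i}$, $\sigma_\alpha=\mathrm{supp}(\alpha)=\{i:a_i\ne0\}$, and $\alpha=\alpha^+-\alpha^-$ with $\alpha^\pm\in\mathbb N^n$ of disjoint supports. For $L\subset[n]$, $\underline L$ is its indicator vector. Juxtaposition of sets/elements means union: $\tau h=\tau\cup\{h\}$, $\tau h\sigma=\tau\cup\{h\}\cup\sigma$. Multigraded squarefree matrices: $A=(c_{ij}x^{\alpha_{ij}})$ ($c_{ij}\in\Bbbk$, $\alpha_{ij}\in\mathbb N^n$) is multigraded if every minor equals $c\,x^\alpha$ for some $c\in\Bbbk$ (possibly $0$) and $\alpha\in\mathbb N^n$. $E_A$ is the system of equations $\gamma_j-\beta_i=\alpha_{ij}$, for all $(i,j)$ with $c_{ij}\neq0$, in unknown vectors $\gamma_j$ ($j\in[l]$), $\beta_i$ ($i\in[s]$); $A$ is squarefree if $E_A$ has a squarefree solution, i.e. one with all $\gamma_j,\beta_i\in\{0,1\}^n$.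 For such $T$: $F_1,F_0$ are the free multigraded modules with bases $w_j$ of degree $\gamma_j$ and $v_i$ of degree $\beta_i$, $\phi_T(w_j)=\sum_i c_{ij}x^{\alpha_{ij}}v_i$, and $\overline g=g+\mathrm{Im}\,\phi_T$. Ideals, complexes and coefficients: fix a monomial order on $R$ and order monomials of $F_0$ by $uv_i>u'v_j$ if $v_i>v_j$, or $i=j$ and $u>u'$, where $v_s>\cdots>v_1$. Then $\mathrm{in}(\mathrm{Im}\,\phi_T)=I_1v_1\oplus\cdots\oplus I_sv_s$ with $I_j$ squarefree monomial ideals; put $\Delta_{I_j}=\{\sigma\subset[n]:\prod_{i\in\sigma}x_i\notin I_j\}$. The elements $\overline{x^\beta v_j}$ with $\beta\in\mathbb N^n$, $\sigma_\beta\in\Delta_{I_j}$, $j\in[s]$, form a $\Bbbk$-basis of $M_A$. For $\beta\in\mathbb N^n$ with $\sigma_\beta\notin\Delta_{I_i}$, the scalars $r_{i,j,\beta}\in\Bbbk$ ($j<i$) are the unique ones with $\overline{x^\beta v_i}=\sum_{j<i}r_{i,j,\beta}\overline{x^{\beta+\beta_i-\beta_j}v_j}$ and $r_{i,j,\beta}=0$ unless $\beta+\beta_i-\beta_j\in\mathbb N^n$ and $\sigma_{\beta+\beta_i-\beta_j}\in\Delta_{I_j}$. Signs: for $L=\{i_1<\cdots<i_t\}$, $\mathrm{sgn}[i_r,L]=(-1)^{r+1}$. For $\sigma\subset F\subset[n]$, $t(\sigma,F)=\pm1$ is the parity sign of the number of transpositions needed to reorder $F$ so that the elements of $\sigma$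 are at the end (keeping the increasing order inside $\sigma$ and inside $F\setminus\sigma$), i.e. $t(\sigma,F)=(-1)^{N}$ with $N=|\{(a,b):a\in\sigma,\ b\in F\setminus\sigma,\ a<b\}|$. Complexes: for $\alpha\in\mathbb Z^n$ put $\alpha_i=\alpha-\beta_i$ and $$\Delta_i^\alpha=\{\tau\subset[n]:\ \tau\cap\sigma_{\alpha_i^-}=\emptyset,\ \tau\cup\sigma_{\alpha_i}\in\Delta_{I_i}\},$$ regarded as a simplicial complex on the vertex set $V=[n]\setminus\sigma_{\alpha_i^-}$ (possibly void; not every vertex need be a face). For a simplicial complex $\Delta$ on a vertex set $V$ and $\tau\in\Delta$, $V_{\tau,\Delta,1}=\{t\in V\setminus\tau:\tau t\in\Delta\}$ and $V_{\tau,\Delta,2}=\{t\in V\setminus\tau:\tau t\notin\Delta\}$. $C^j(\Delta)$ is the $\Bbbk$-vector space with basis $\{\tau^*:\tau\in\Delta,|\tau|=j+1\}$, $j\ge-1$ (and is $0$ for other $j$), and $C^\bullet(\Delta)$ is the augmented cochain complex with differential $\tau^*\mapsto\sum_{t\in V_{\tau,\Delta,1}}\mathrm{sgn}[t,\tau t](\tau t)^*$. *)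

theory Defs
  imports
    "HOL-Library.Poly_Mapping"
    "HOL-Library.Function_Algebras"
    "HOL-Library.Extended_Nat"
    "Jordan_Normal_Form.Determinant"
    "Jordan_Normal_Form.DL_Submatrix"
begin

text \<open>
  The variables \<open>x\<^sub>1, \<dots>, x\<^sub>n\<close> are indexed by a finite linearly ordered type \<open>'n\<close>, which plays the
  role of \<open>[n]\<close> with its usual order.  Rows and columns of a matrix are numbered from \<open>0\<close>, so that
  \<open>[s]\<close> is \<open>{..<s}\<close> and \<open>v\<^sub>1\<close>, \<open>\<beta>\<^sub>1\<close>, \<open>\<alpha>\<^sub>1\<close> are the objects with index \<open>0\<close>.

  The support of an exponent vector is its set of \<^const>\<open>Poly_Mapping.keys\<close>.  The order that the library puts
  on \<open>'n \<Rightarrow>\<^sub>0 nat\<close> is lexicographic and is never used below; the relation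
  \<open>\<beta> \<in> \<nat>\<^sup>n\<close> for a difference \<open>\<beta>\<close> is always written out componentwise.
\<close>

type_synonym ('n, 'k) poly_ring = "('n \<Rightarrow>\<^sub>0 nat) \<Rightarrow>\<^sub>0 'k"
type_synonym ('n, 'k) laurent_ring = "('n \<Rightarrow>\<^sub>0 int) \<Rightarrow>\<^sub>0 'k"


section \<open>Exponent vectors, signs\<close>

definition to_int_vec :: "('n \<Rightarrow>\<^sub>0 nat) \<Rightarrow> ('n \<Rightarrow>\<^sub>0 int)" where
  "to_int_vec u = Poly_Mapping.map int u"

definition pos_part :: "('n \<Rightarrow>\<^sub>0 int) \<Rightarrow> ('n \<Rightarrow>\<^sub>0 nat)" where
  "pos_part d = Poly_Mapping.map nat d"

definition neg_part :: "('n \<Rightarrow>\<^sub>0 int) \<Rightarrow> ('n \<Rightarrow>\<^sub>0 nat)" where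
  "neg_part d = Poly_Mapping.map (\<lambda>z. nat (- z)) d"

definition indicator_vec :: "'n set \<Rightarrow> ('n \<Rightarrow>\<^sub>0 nat)" where
  "indicator_vec L = (\<Sum>i\<in>L. Poly_Mapping.single i 1)"

text \<open>\<open>sgn[i, L]\<close>: if \<open>i\<close> is the \<open>r\<close>-th element of \<open>L\<close>, then \<open>r - 1\<close> elements of \<open>L\<close> precede it.\<close>

definition sgn_in :: "'n::linorder \<Rightarrow> 'n set \<Rightarrow> 'a::ring_1" where
  "sgn_in i L = (-1) ^ card {m \<in> L. m < i}"

definition t_sgn :: "'n::linorder set \<Rightarrow> 'n set \<Rightarrow> 'a::ring_1" where
  "t_sgn \<sigma> F = (-1) ^ card {(a, b). a \<in> \<sigma> \<and> b \<in> F - \<sigma> \<and> a < b}"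

text \<open>The variable \<open>x\<^sub>i\<close> and the product \<open>\<Prod>\<^bsub>i\<in>F\<^esub> x\<^sub>i\<close>, both in the polynomial ring and in the ring of
  Laurent polynomials.\<close>

definition var :: "'n \<Rightarrow> (('n \<Rightarrow>\<^sub>0 'e::semiring_1) \<Rightarrow>\<^sub>0 'k::comm_ring_1)" where
  "var i = Poly_Mapping.single (Poly_Mapping.single i 1) 1"

definition var_prod :: "'n set \<Rightarrow> (('n \<Rightarrow>\<^sub>0 'e::semiring_1) \<Rightarrow>\<^sub>0 'k::comm_ring_1)" where
  "var_prod F = (\<Prod>i\<in>F. var i)"


section \<open>Vector space generalities\<close>

text \<open>
  The dimension of the image of the subspace \<open>Z\<close> in the quotient by the subspace \<open>B\<close>
  (that is, of \<open>Z/B\<close> if \<open>B \<subseteq> Z\<close>): the supremum of the sizes of the finite subsets of \<open>Z\<close> that are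
  linearly independent modulo \<open>B\<close>.
\<close>

definition quotient_dim ::
    "('k::field \<Rightarrow> 'v::ab_group_add \<Rightarrow> 'v) \<Rightarrow> 'v set \<Rightarrow> 'v set \<Rightarrow> enat" where
  "quotient_dim scale Z B =
     (SUP S \<in> {S. finite S \<and> S \<subseteq> Z \<and>
                 (\<forall>u. (\<Sum>v\<in>S. scale (u v) v) \<in> B \<longrightarrow> (\<forall>v\<in>S. u v = 0))}. enat (card S))"

text \<open>A cochain complex whose spaces \<open>C r\<close> all lie in one ambient space, with one linear map \<open>d\<close> of
  the ambient space inducing all the differentials.\<close>

definition cochain_complex ::
    "('k::field \<Rightarrow> 'v::ab_group_add \<Rightarrow> 'v) \<Rightarrow> (int \<Rightarrow> 'v set) \<Rightarrow> ('v \<Rightarrow> 'v) \<Rightarrow> bool" where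
  "cochain_complex scale C d \<longleftrightarrow>
     Vector_Spaces.linear scale scale d \<and>
     (\<forall>r. module.subspace scale (C r)) \<and>
     (\<forall>r. \<forall>f\<in>C r. d f \<in> C (r + 1)) \<and>
     (\<forall>r. \<forall>f\<in>C r. d (d f) = 0)"

definition cohomology_dim ::
    "('k::field \<Rightarrow> 'v::ab_group_add \<Rightarrow> 'v) \<Rightarrow> (int \<Rightarrow> 'v set) \<Rightarrow> ('v \<Rightarrow> 'v) \<Rightarrow> int \<Rightarrow> enat" where
  "cohomology_dim scale C d r = quotient_dim scale {f \<in> C r. d f = 0} (d ` C (r - 1))"


section \<open>Multigraded squarefree matrices\<close>

definition monomial_matrix ::
    "nat \<Rightarrow> nat \<Rightarrow> (nat \<Rightarrow> nat \<Rightarrow> 'k::comm_ring_1) \<Rightarrow> (nat \<Rightarrow> nat \<Rightarrow> ('n \<Rightarrow>\<^sub>0 nat)) \<Rightarrow>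
     ('n, 'k) poly_ring mat" where
  "monomial_matrix s l c a = mat s l (\<lambda>(i, j). Poly_Mapping.single (a i j) (c i j))"

definition multigraded :: "('n, 'k::comm_ring_1) poly_ring mat \<Rightarrow> bool" where
  "multigraded A \<longleftrightarrow>
     (\<forall>I J. I \<subseteq> {..<dim_row A} \<and> J \<subseteq> {..<dim_col A} \<and> card I = card J \<longrightarrow>
        (\<exists>c u. det (submatrix A I J) = Poly_Mapping.single u c))"

definition squarefree_vec :: "('n \<Rightarrow>\<^sub>0 nat) \<Rightarrow> bool" where
  "squarefree_vec u \<longleftrightarrow> (\<forall>k. Poly_Mapping.lookup u k \<in> {0, 1})"

definition squarefree_solution ::
    "nat \<Rightarrow> nat \<Rightarrow> (nat \<Rightarrow> nat \<Rightarrow> 'k::zero) \<Rightarrow> (nat \<Rightarrow> nat \<Rightarrow> ('n \<Rightarrow>\<^sub>0 nat)) \<Rightarrow>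
     (nat \<Rightarrow> ('n \<Rightarrow>\<^sub>0 nat)) \<Rightarrow> (nat \<Rightarrow> ('n \<Rightarrow>\<^sub>0 nat)) \<Rightarrow> bool" where
  "squarefree_solution s l c a \<gamma> \<beta> \<longleftrightarrow>
     (\<forall>j<l. squarefree_vec (\<gamma> j)) \<and> (\<forall>i<s. squarefree_vec (\<beta> i)) \<and>
     (\<forall>i<s. \<forall>j<l. c i j \<noteq> 0 \<longrightarrow> to_int_vec (\<gamma> j) - to_int_vec (\<beta> i) = to_int_vec (a i j))"


section \<open>The module as a quotient of a free module\<close>

text \<open>
  The elements \<open>\<Sum>\<^bsub>i<s\<^esub> p\<^sub>i v\<^sub>i\<close> of the free module \<open>F\<^sub>0\<close> are the functions \<open>i \<mapsto> p\<^sub>i\<close> that vanish for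
  \<open>i \<ge> s\<close>.  The image of \<open>\<phi>\<^sub>T\<close> is the column module of the matrix; the solution \<open>T\<close> only enters
  through the degrees \<open>\<beta>\<^sub>i\<close> of the generators \<open>v\<^sub>i\<close>.
\<close>

definition free_module :: "nat \<Rightarrow> (nat \<Rightarrow> 'r::zero) set" where
  "free_module s = {f. \<forall>i\<ge>s. f i = 0}"

definition column_module :: "'r::comm_ring_1 mat \<Rightarrow> (nat \<Rightarrow> 'r) set" where
  "column_module A =
     range (\<lambda>w i. if i < dim_row A then (\<Sum>j<dim_col A. A $$ (i, j) * w j) else 0)"

definition gen_mult :: "'r::zero \<Rightarrow> nat \<Rightarrow> (nat \<Rightarrow> 'r)" where
  "gen_mult p i = (\<lambda>k. if k = i then p else 0)"

abbreviation mono_elem :: "('n \<Rightarrow>\<^sub>0 nat) \<Rightarrow> nat \<Rightarrow> (nat \<Rightarrow> ('n, 'k::comm_ring_1) poly_ring)" where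
  "mono_elem u i \<equiv> gen_mult (Poly_Mapping.single u 1) i"


section \<open>Initial modules and standard monomials\<close>

definition monomial_order :: "(('n \<Rightarrow>\<^sub>0 nat) \<Rightarrow> ('n \<Rightarrow>\<^sub>0 nat) \<Rightarrow> bool) \<Rightarrow> bool" where
  "monomial_order leq \<longleftrightarrow>
     class.linorder leq (\<lambda>u v. leq u v \<and> u \<noteq> v) \<and>
     (\<forall>u. leq 0 u) \<and> (\<forall>u v w. leq u v \<longrightarrow> leq (u + w) (v + w))"

text \<open>Pairs \<open>(i, u)\<close> stand for the monomials \<open>x\<^sup>u v\<^sub>i\<close>; generators with larger index are larger.\<close>

fun module_le ::
    "(('n \<Rightarrow>\<^sub>0 nat) \<Rightarrow> ('n \<Rightarrow>\<^sub>0 nat) \<Rightarrow> bool) \<Rightarrow>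
     nat \<times> ('n \<Rightarrow>\<^sub>0 nat) \<Rightarrow> nat \<times> ('n \<Rightarrow>\<^sub>0 nat) \<Rightarrow> bool" where
  "module_le leq (j, v) (i, u) \<longleftrightarrow> j < i \<or> (j = i \<and> leq v u)"

definition monomials_of ::
    "(nat \<Rightarrow> ('n, 'k::zero) poly_ring) \<Rightarrow> (nat \<times> ('n \<Rightarrow>\<^sub>0 nat)) set" where
  "monomials_of f = {(i, u). u \<in> Poly_Mapping.keys (f i)}"

definition is_leading_monomial ::
    "(('n \<Rightarrow>\<^sub>0 nat) \<Rightarrow> ('n \<Rightarrow>\<^sub>0 nat) \<Rightarrow> bool) \<Rightarrow>
     (nat \<Rightarrow> ('n, 'k::zero) poly_ring) \<Rightarrow> nat \<times> ('n \<Rightarrow>\<^sub>0 nat) \<Rightarrow> bool" where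
  "is_leading_monomial leq f m \<longleftrightarrow>
     m \<in> monomials_of f \<and> (\<forall>m'\<in>monomials_of f. module_le leq m' m)"

definition initial_module ::
    "(('n \<Rightarrow>\<^sub>0 nat) \<Rightarrow> ('n \<Rightarrow>\<^sub>0 nat) \<Rightarrow> bool) \<Rightarrow>
     (nat \<Rightarrow> ('n, 'k::comm_ring_1) poly_ring) set \<Rightarrow> (nat \<Rightarrow> ('n, 'k) poly_ring) set" where
  "initial_module leq N =
     module.span (\<lambda>p f i. p * f i)
       {mono_elem u i | u i. \<exists>f\<in>N. is_leading_monomial leq f (i, u)}"

definition initial_ideal ::
    "(('n \<Rightarrow>\<^sub>0 nat) \<Rightarrow> ('n \<Rightarrow>\<^sub>0 nat) \<Rightarrow> bool) \<Rightarrow>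
     (nat \<Rightarrow> ('n, 'k::comm_ring_1) poly_ring) set \<Rightarrow> nat \<Rightarrow> ('n, 'k) poly_ring set" where
  "initial_ideal leq N j = {p. gen_mult p j \<in> initial_module leq N}"

definition initial_complex ::
    "(('n \<Rightarrow>\<^sub>0 nat) \<Rightarrow> ('n \<Rightarrow>\<^sub>0 nat) \<Rightarrow> bool) \<Rightarrow>
     (nat \<Rightarrow> ('n, 'k::comm_ring_1) poly_ring) set \<Rightarrow> nat \<Rightarrow> 'n set set" where
  "initial_complex leq N j = {\<sigma>. var_prod \<sigma> \<notin> initial_ideal leq N j}"

text \<open>
  The scalars \<open>r\<^bsub>i,j,u\<^esub>\<close> (as a function of \<open>j\<close>, extended by \<open>0\<close> to \<open>j \<ge> i\<close>) that express the class of
  \<open>x\<^sup>u v\<^sub>i\<close> through standard monomials.  In the exponent \<open>u + \<beta> i - \<beta> j\<close> subtraction is truncated,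
  but wherever \<open>\<rho> j \<noteq> 0\<close> it is required to be a true subtraction.
\<close>

definition reduction_coeffs ::
    "(('n \<Rightarrow>\<^sub>0 nat) \<Rightarrow> ('n \<Rightarrow>\<^sub>0 nat) \<Rightarrow> bool) \<Rightarrow>
     (nat \<Rightarrow> ('n, 'k::comm_ring_1) poly_ring) set \<Rightarrow> (nat \<Rightarrow> ('n \<Rightarrow>\<^sub>0 nat)) \<Rightarrow>
     nat \<Rightarrow> ('n \<Rightarrow>\<^sub>0 nat) \<Rightarrow> (nat \<Rightarrow> 'k)" where
  "reduction_coeffs leq N \<beta> i u =
     (THE \<rho>.
        (\<forall>j. \<rho> j \<noteq> 0 \<longrightarrow>
           j < i \<and>
           (\<forall>k. Poly_Mapping.lookup (\<beta> j) k \<le> Poly_Mapping.lookup (u + \<beta> i) k) \<and>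
           Poly_Mapping.keys (u + \<beta> i - \<beta> j) \<in> initial_complex leq N j) \<and>
        mono_elem u i
          - (\<Sum>j<i. gen_mult (Poly_Mapping.single (u + \<beta> i - \<beta> j) (\<rho> j)) j) \<in> N)"


section \<open>Local cohomology\<close>

text \<open>
  For \<open>R\<close>-submodules \<open>N \<subseteq> P\<close> of a free module, the local cohomology of \<open>M = P/N\<close> with support in
  \<open>\<mm> = (x\<^sub>1, \<dots>, x\<^sub>n)\<close> is taken to be the cohomology of the Cech complex
  \<open>0 \<rightarrow> M \<rightarrow> \<Oplus>\<^sub>i M\<^bsub>x\<^sub>i\<^esub> \<rightarrow> \<Oplus>\<^bsub>i<j\<^esub> M\<^bsub>x\<^sub>i x\<^sub>j\<^esub> \<rightarrow> \<dots> \<rightarrow> M\<^bsub>x\<^sub>1 \<dots> x\<^sub>n\<^esub> \<rightarrow> 0\<close> (as, e.g., in Stanley,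
  Combinatorics and Commutative Algebra, Chapter I), which is also the source of its multigrading.

  With \<open>x\<^sub>F = \<Prod>\<^bsub>i\<in>F\<^esub> x\<^sub>i\<close>, fractions \<open>m / x\<^sub>F\<^sup>t\<close> with \<open>m \<in> P\<close> are vectors of Laurent polynomials.
  They form \<open>localized F P\<close>, and such a fraction represents zero in \<open>M\<^bsub>x\<^sub>F\<^esub>\<close> iff its product with some
  power of \<open>x\<^sub>F\<close> lies in \<open>N\<close>, i.e. iff it belongs to \<open>localized F N\<close>.  Hence \<open>M\<^bsub>x\<^sub>F\<^esub>\<close> is
  \<open>localized F P\<close> modulo \<open>localized F N\<close>, and the localization maps \<open>M\<^bsub>x\<^sub>F\<^esub> \<rightarrow> M\<^bsub>x\<^sub>G\<^esub>\<close> (\<open>F \<subseteq> G\<close>) are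
  induced by inclusion.
\<close>

definition to_laurent :: "('n, 'k::comm_ring_1) poly_ring \<Rightarrow> ('n, 'k) laurent_ring" where
  "to_laurent p = (\<Sum>u\<in>Poly_Mapping.keys p. Poly_Mapping.single (to_int_vec u) (Poly_Mapping.lookup p u))"

definition localized ::
    "'n set \<Rightarrow> (nat \<Rightarrow> ('n, 'k::comm_ring_1) poly_ring) set \<Rightarrow> (nat \<Rightarrow> ('n, 'k) laurent_ring) set" where
  "localized F P = {w. \<exists>t. \<exists>m\<in>P. \<forall>i. var_prod F ^ t * w i = to_laurent (m i)}"

text \<open>Representatives of the cochains in \<open>\<Oplus>\<^bsub>|F| = p\<^esub> M\<^bsub>x\<^sub>F\<^esub>\<close>, as families indexed by the \<open>F\<close>.\<close>

definition cech_cochains ::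
    "(nat \<Rightarrow> ('n, 'k::comm_ring_1) poly_ring) set \<Rightarrow> int \<Rightarrow>
     ('n set \<Rightarrow> nat \<Rightarrow> ('n, 'k) laurent_ring) set" where
  "cech_cochains P p =
     {z. (\<forall>F. int (card F) = p \<longrightarrow> z F \<in> localized F P) \<and>
         (\<forall>F. int (card F) \<noteq> p \<longrightarrow> z F = 0)}"

definition cech_differential ::
    "('n::linorder set \<Rightarrow> nat \<Rightarrow> ('n, 'k::comm_ring_1) laurent_ring) \<Rightarrow>
     ('n set \<Rightarrow> nat \<Rightarrow> ('n, 'k) laurent_ring)" where
  "cech_differential z = (\<lambda>G i. \<Sum>k\<in>G. sgn_in k G * z (G - {k}) i)"

definition cech_cocycles ::
    "(nat \<Rightarrow> ('n::linorder, 'k::comm_ring_1) poly_ring) set \<Rightarrow>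
     (nat \<Rightarrow> ('n, 'k) poly_ring) set \<Rightarrow> int \<Rightarrow> ('n set \<Rightarrow> nat \<Rightarrow> ('n, 'k) laurent_ring) set" where
  "cech_cocycles P N p =
     {z \<in> cech_cochains P p. cech_differential z \<in> cech_cochains N (p + 1)}"

definition cech_coboundaries ::
    "(nat \<Rightarrow> ('n::linorder, 'k::comm_ring_1) poly_ring) set \<Rightarrow>
     (nat \<Rightarrow> ('n, 'k) poly_ring) set \<Rightarrow> int \<Rightarrow> ('n set \<Rightarrow> nat \<Rightarrow> ('n, 'k) laurent_ring) set" where
  "cech_coboundaries P N p =
     {z. \<exists>y\<in>cech_cochains P (p - 1). z - cech_differential y \<in> cech_cochains N p}"

text \<open>With \<open>deg v\<^sub>i = \<beta> i\<close>, the monomial \<open>x\<^sup>d v\<^sub>i\<close> has degree \<open>d + \<beta> i\<close>.\<close>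

definition cech_homogeneous ::
    "(nat \<Rightarrow> ('n \<Rightarrow>\<^sub>0 nat)) \<Rightarrow> ('n \<Rightarrow>\<^sub>0 int) \<Rightarrow>
     ('n set \<Rightarrow> nat \<Rightarrow> ('n, 'k::zero) laurent_ring) set" where
  "cech_homogeneous \<beta> \<alpha> = {z. \<forall>F i. Poly_Mapping.keys (z F i) \<subseteq> {\<alpha> - to_int_vec (\<beta> i)}}"

definition cech_scale ::
    "'k::comm_ring_1 \<Rightarrow> ('n set \<Rightarrow> nat \<Rightarrow> ('n, 'k) laurent_ring) \<Rightarrow>
     ('n set \<Rightarrow> nat \<Rightarrow> ('n, 'k) laurent_ring)" where
  "cech_scale c z = (\<lambda>F i. Poly_Mapping.map ((*) c) (z F i))"

text \<open>The dimension of the degree \<open>\<alpha>\<close> component of the \<open>p\<close>-th local cohomology module of \<open>P/N\<close>,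
  which consists of the classes of the homogeneous cocycles of degree \<open>\<alpha>\<close>.\<close>

definition local_cohomology_dim ::
    "(nat \<Rightarrow> ('n::linorder, 'k::field) poly_ring) set \<Rightarrow> (nat \<Rightarrow> ('n, 'k) poly_ring) set \<Rightarrow>
     (nat \<Rightarrow> ('n \<Rightarrow>\<^sub>0 nat)) \<Rightarrow> int \<Rightarrow> ('n \<Rightarrow>\<^sub>0 int) \<Rightarrow> enat" where
  "local_cohomology_dim P N \<beta> p \<alpha> =
     quotient_dim cech_scale (cech_cocycles P N p \<inter> cech_homogeneous \<beta> \<alpha>) (cech_coboundaries P N p)"


section \<open>The combinatorial complex\<close>

definition shifted :: "(nat \<Rightarrow> ('n \<Rightarrow>\<^sub>0 nat)) \<Rightarrow> ('n \<Rightarrow>\<^sub>0 int) \<Rightarrow> nat \<Rightarrow> ('n \<Rightarrow>\<^sub>0 int)" where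
  "shifted \<beta> \<alpha> i = \<alpha> - to_int_vec (\<beta> i)"

definition neg_support :: "(nat \<Rightarrow> ('n \<Rightarrow>\<^sub>0 nat)) \<Rightarrow> ('n \<Rightarrow>\<^sub>0 int) \<Rightarrow> nat \<Rightarrow> 'n set" where
  "neg_support \<beta> \<alpha> i = Poly_Mapping.keys (neg_part (shifted \<beta> \<alpha> i))"

definition degree_complex ::
    "(('n \<Rightarrow>\<^sub>0 nat) \<Rightarrow> ('n \<Rightarrow>\<^sub>0 nat) \<Rightarrow> bool) \<Rightarrow>
     (nat \<Rightarrow> ('n, 'k::comm_ring_1) poly_ring) set \<Rightarrow> (nat \<Rightarrow> ('n \<Rightarrow>\<^sub>0 nat)) \<Rightarrow>
     ('n \<Rightarrow>\<^sub>0 int) \<Rightarrow> nat \<Rightarrow> 'n set set" where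
  "degree_complex leq N \<beta> \<alpha> i =
     {\<tau>. \<tau> \<inter> neg_support \<beta> \<alpha> i = {} \<and> \<tau> \<union> Poly_Mapping.keys (shifted \<beta> \<alpha> i) \<in> initial_complex leq N i}"

definition ext_vertices :: "'n set \<Rightarrow> 'n set set \<Rightarrow> 'n set \<Rightarrow> 'n set" where
  "ext_vertices V \<Delta> \<tau> = {t \<in> V - \<tau>. insert t \<tau> \<in> \<Delta>}"

definition non_ext_vertices :: "'n set \<Rightarrow> 'n set set \<Rightarrow> 'n set \<Rightarrow> 'n set" where
  "non_ext_vertices V \<Delta> \<tau> = {t \<in> V - \<tau>. insert t \<tau> \<notin> \<Delta>}"

definition degree_shift :: "(nat \<Rightarrow> ('n \<Rightarrow>\<^sub>0 nat)) \<Rightarrow> ('n \<Rightarrow>\<^sub>0 int) \<Rightarrow> nat \<Rightarrow> int" where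
  "degree_shift \<beta> \<alpha> i = int (card (neg_support \<beta> \<alpha> i)) - int (card (neg_support \<beta> \<alpha> 0))"

text \<open>
  The direct sum of the spaces \<open>C\<^sup>\<bullet>(\<Delta>\<^sub>i\<^sup>\<alpha>)\<close> is realised inside the space with basis all pairs
  \<open>(i, \<tau>)\<close>, where \<open>(i, \<tau>)\<close> stands for \<open>\<tau>\<^sup>*\<close> in the \<open>i\<close>-th summand.
\<close>

definition L_space ::
    "nat \<Rightarrow> (('n \<Rightarrow>\<^sub>0 nat) \<Rightarrow> ('n \<Rightarrow>\<^sub>0 nat) \<Rightarrow> bool) \<Rightarrow>
     (nat \<Rightarrow> ('n, 'k::comm_ring_1) poly_ring) set \<Rightarrow> (nat \<Rightarrow> ('n \<Rightarrow>\<^sub>0 nat)) \<Rightarrow> ('n \<Rightarrow>\<^sub>0 int) \<Rightarrow>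
     int \<Rightarrow> (nat \<times> 'n set \<Rightarrow>\<^sub>0 'k) set" where
  "L_space s leq N \<beta> \<alpha> r =
     {f. Poly_Mapping.keys f \<subseteq> {(i, \<tau>). i < s \<and> \<tau> \<in> degree_complex leq N \<beta> \<alpha> i \<and>
                           int (card \<tau>) = (r - degree_shift \<beta> \<alpha> i) + 1}}"

definition L_diff_basis ::
    "(('n::linorder \<Rightarrow>\<^sub>0 nat) \<Rightarrow> ('n \<Rightarrow>\<^sub>0 nat) \<Rightarrow> bool) \<Rightarrow>
     (nat \<Rightarrow> ('n, 'k::field) poly_ring) set \<Rightarrow> (nat \<Rightarrow> ('n \<Rightarrow>\<^sub>0 nat)) \<Rightarrow> ('n \<Rightarrow>\<^sub>0 int) \<Rightarrow>
     nat \<times> 'n set \<Rightarrow> (nat \<times> 'n set \<Rightarrow>\<^sub>0 'k)" where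
  "L_diff_basis leq N \<beta> \<alpha> = (\<lambda>(i, \<tau>).
     let \<Delta> = degree_complex leq N \<beta> \<alpha> i; \<sigma> = neg_support \<beta> \<alpha>; V = - \<sigma> i in
       (\<Sum>h\<in>ext_vertices V \<Delta> \<tau>. Poly_Mapping.single (i, insert h \<tau>) (sgn_in h (insert h \<tau>)))
     + (\<Sum>h\<in>non_ext_vertices V \<Delta> \<tau>. \<Sum>j<i.
          let G = insert h \<tau> \<union> \<sigma> i in
          Poly_Mapping.single (j, G - \<sigma> j)
            (sgn_in h (insert h \<tau>)
              * reduction_coeffs leq N \<beta> i (pos_part (shifted \<beta> \<alpha> i) + indicator_vec G) j
              * (t_sgn (\<sigma> i) G / t_sgn (\<sigma> j) G))))"

definition L_scale :: "'k::comm_ring_1 \<Rightarrow> ('b \<Rightarrow>\<^sub>0 'k) \<Rightarrow> ('b \<Rightarrow>\<^sub>0 'k)" where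
  "L_scale c f = Poly_Mapping.map ((*) c) f"

definition L_diff ::
    "(('n::linorder \<Rightarrow>\<^sub>0 nat) \<Rightarrow> ('n \<Rightarrow>\<^sub>0 nat) \<Rightarrow> bool) \<Rightarrow>
     (nat \<Rightarrow> ('n, 'k::field) poly_ring) set \<Rightarrow> (nat \<Rightarrow> ('n \<Rightarrow>\<^sub>0 nat)) \<Rightarrow> ('n \<Rightarrow>\<^sub>0 int) \<Rightarrow>
     (nat \<times> 'n set \<Rightarrow>\<^sub>0 'k) \<Rightarrow> (nat \<times> 'n set \<Rightarrow>\<^sub>0 'k)" where
  "L_diff leq N \<beta> \<alpha> f =
     (\<Sum>b\<in>Poly_Mapping.keys f. L_scale (Poly_Mapping.lookup f b) (L_diff_basis leq N \<beta> \<alpha> b))"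

end

theory Submission
  imports Defs
begin

text \<open>
  The degree \<open>\<alpha>\<close> part of the image of \<open>\<phi>\<^sub>T\<close> localized at \<open>x\<^sub>F\<close> consists of the vectors
  \<open>(\<xi>\<^sub>i x\<^bsup>\<alpha> - \<beta>\<^sub>i\<^esup>)\<^sub>i\<close> with \<open>\<xi> = c \<eta>\<close>, where \<open>\<eta>\<close> is supported on the columns \<open>j\<close> whose degree
  \<open>\<gamma>\<^sub>j\<close> is at most \<open>\<alpha>\<close> outside \<open>F\<close>.  As the \<open>\<gamma>\<^sub>j\<close> are squarefree, this space of coefficient vectors depends
  only on \<open>F \<union> {k. \<alpha>\<^sub>k > 0}\<close>, and it is also what governs leading terms in degrees of \<open>\<nat>\<^sup>n\<close>
  with that support.  Hence the \<open>v\<^sub>i\<close> with \<open>F - \<sigma>\<^sub>i \<in> \<Delta>\<^sub>i\<^sup>\<alpha>\<close> form a basis of the degree \<open>\<alpha>\<close> part of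
  \<open>M\<^bsub>x\<^sub>F\<^esub>\<close>, where \<open>\<sigma>\<^sub>i\<close> is the negative support of \<open>\<alpha> - \<beta>\<^sub>i\<close>, and normal forms are given by
  the \<open>r\<^bsub>i,j,u\<^esub>\<close>.  Writing the Cech differential in these bases, rescaled by the signs \<open>t(\<sigma>\<^sub>i, F)\<close>, gives
  exactly the complex \<open>L\<^sup>\<alpha>\<close>.
\<close>

section \<open>Dimensions of quotients\<close>

text \<open>\<open>\<Phi>\<close> induces an isomorphism of the quotients: sets independent modulo
  \<open>B\<close> map injectively onto sets independent modulo \<open>B'\<close>, and the latter
  lift to sets of preimages. \<open>B\<close> and \<open>B'\<close> are compared on \<open>Z\<close>
  only, because the coboundaries to which this is applied are not confined to homogeneous
  families.\<close>

lemma quotient_dim_image: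
  assumes lin: "Vector_Spaces.linear scale scale' \<Phi>"
    and Z: "module.subspace scale Z"
    and im: "\<Phi> ` Z = Z'"
    and B: "\<And>z. z \<in> Z \<Longrightarrow> \<Phi> z \<in> B' \<longleftrightarrow> z \<in> B" and "0 \<in> B"
  shows "quotient_dim scale Z B = quotient_dim scale' Z' B'"
proof -
  interpret Vector_Spaces.linear scale scale' \<Phi> by (fact lin)
  have comb: "(\<Sum>v\<in>S. scale (u v) v) \<in> Z" if "S \<subseteq> Z" for S u
    using that Z by (intro vs1.subspace_sum vs1.subspace_scale) auto
  have map: "\<Phi> (\<Sum>v\<in>S. scale (u v) v) = (\<Sum>v\<in>S. scale' (u v) (\<Phi> v))" for S u
    by (simp add: sum scale)
  define I where "I = {S. finite S \<and> S \<subseteq> Z \<and> (\<forall>u. (\<Sum>v\<in>S. scale (u v) v) \<in> B \<longrightarrow> (\<forall>v\<in>S. u v = 0))}"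
  define I' where "I' = {S. finite S \<and> S \<subseteq> Z' \<and> (\<forall>u. (\<Sum>v\<in>S. scale' (u v) v) \<in> B' \<longrightarrow> (\<forall>v\<in>S. u v = 0))}"
  have indep: "\<forall>v\<in>S. u v = 0" if "S \<in> I" "(\<Sum>v\<in>S. scale (u v) v) \<in> B" for S u
  proof -
    from that(1) have "\<forall>u. (\<Sum>v\<in>S. scale (u v) v) \<in> B \<longrightarrow> (\<forall>v\<in>S. u v = 0)"
      unfolding I_def by simp
    from this[THEN spec, of u] that(2) show ?thesis by simp
  qed
  have indep': "\<forall>v\<in>S. u v = 0" if "S \<in> I'" "(\<Sum>v\<in>S. scale' (u v) v) \<in> B'" for S u
  proof -
    from that(1) have "\<forall>u. (\<Sum>v\<in>S. scale' (u v) v) \<in> B' \<longrightarrow> (\<forall>v\<in>S. u v = 0)"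
      unfolding I'_def by simp
    from this[THEN spec, of u] that(2) show ?thesis by simp
  qed
  have inj: "inj_on \<Phi> S" if "S \<in> I" for S
  proof (rule inj_onI, rule ccontr)
    fix v w assume vw: "v \<in> S" "w \<in> S" "\<Phi> v = \<Phi> w" "v \<noteq> w"
    \<comment> \<open>These coefficients represent \<open>v - w\<close>, whose image is that of 0.
      As \<open>0 \<in> B\<close>, it follows that \<open>v - w\<close> lies in \<open>B\<close>,
      against independence modulo \<open>B\<close>.\<close>
    define u where "u x = (if x = v then 1 else if x = w then -1 else (0::'a))" for x
    have fin: "finite S" and SZ: "S \<subseteq> Z" using that by (auto simp: I_def)
    have "(\<Sum>x\<in>S. scale (u x) x) = (\<Sum>x\<in>{v,w}. scale (u x) x)"
      by (rule sum.mono_neutral_right) (use vw fin in \<open>auto simp: u_def\<close>)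
    also have "\<dots> = v - w" using vw by (simp add: u_def)
    finally have eq: "(\<Sum>x\<in>S. scale (u x) x) = v - w" .
    have "\<Phi> (v - w) = \<Phi> 0" using vw by (simp add: diff zero)
    moreover have "0 \<in> Z" using Z by (rule vs1.subspace_0)
    moreover have "v - w \<in> Z" using comb[OF SZ, of u] eq by simp
    ultimately have "v - w \<in> B" using B[of 0] B[of "v - w"] \<open>0 \<in> B\<close> by simp
    hence "u v = 0" using indep[OF that, of u] eq vw(1) by simp
    thus False by (simp add: u_def)
  qed
  have "enat ` card ` I = enat ` card ` I'"
  proof -
    have "card ` I = card ` I'"
    proof (intro equalityI subsetI)
      fix m assume "m \<in> card ` I"
      then obtain S where S: "S \<in> I" "m = card S" by auto
      hence fin: "finite S" and SZ: "S \<subseteq> Z" by (auto simp: I_def)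
      have "\<Phi> ` S \<in> I'"
        unfolding I'_def
      proof (intro CollectI conjI allI impI)
        show "finite (\<Phi> ` S)" using fin by simp
        show "\<Phi> ` S \<subseteq> Z'" using SZ im by auto
        fix u assume "(\<Sum>v\<in>\<Phi> ` S. scale' (u v) v) \<in> B'"
        hence "\<Phi> (\<Sum>v\<in>S. scale (u (\<Phi> v)) v) \<in> B'"
          using inj[OF S(1)] by (simp add: sum.reindex map)
        hence "(\<Sum>v\<in>S. scale (u (\<Phi> v)) v) \<in> B" using B[OF comb[OF SZ]] by simp
        hence "\<forall>v\<in>S. u (\<Phi> v) = 0" by (rule indep[OF S(1)])
        thus "\<forall>v\<in>\<Phi> ` S. u v = 0" by auto
      qed
      moreover have "card (\<Phi> ` S) = m" using inj[OF S(1)] S(2) by (simp add: card_image)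
      ultimately show "m \<in> card ` I'" by force
    next
      fix m assume "m \<in> card ` I'"
      then obtain S' where S': "S' \<in> I'" "m = card S'" by auto
      hence "finite S'" "S' \<subseteq> \<Phi> ` Z" by (auto simp: I'_def im)
      \<comment> \<open>One preimage is chosen for each element of \<open>S'\<close>, so
        \<open>\<Phi>\<close> is injective on \<open>S\<close> and coefficients on \<open>S\<close>
        can be transferred to \<open>S'\<close>.\<close>
      then obtain S where S: "S \<subseteq> Z" "S' = \<Phi> ` S" "inj_on \<Phi> S"
        unfolding subset_image_inj by blast
      have "finite S" using \<open>finite S'\<close> S by (simp add: finite_image_iff)
      have "S \<in> I" unfolding I_def
      proof (intro CollectI conjI allI impI ballI)
        show "finite S" "S \<subseteq> Z" by fact+
        fix u v assume "(\<Sum>v\<in>S. scale (u v) v) \<in> B" and v: "v \<in> S"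
        hence "\<Phi> (\<Sum>v\<in>S. scale (u v) v) \<in> B'" using B[OF comb[OF S(1)]] by simp
        also have "\<Phi> (\<Sum>v\<in>S. scale (u v) v) = (\<Sum>x\<in>S. scale' (u (the_inv_into S \<Phi> (\<Phi> x))) (\<Phi> x))"
          by (simp add: map the_inv_into_f_f[OF S(3)])
        also have "\<dots> = (\<Sum>y\<in>S'. scale' (u (the_inv_into S \<Phi> y)) y)"
          using S(3) by (simp add: S(2) sum.reindex)
        finally have "\<forall>v\<in>S'. u (the_inv_into S \<Phi> v) = 0"
          by (rule indep'[OF S'(1)])
        hence "u (the_inv_into S \<Phi> (\<Phi> v)) = 0" using S(2) v by simp
        thus "u v = 0" using the_inv_into_f_f[OF S(3) v] by simp
      qed
      moreover have "card S = m" using S S' by (simp add: card_image)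
      ultimately show "m \<in> card ` I" by force
    qed
    thus ?thesis by simp
  qed
  thus ?thesis unfolding quotient_dim_def I_def I'_def by (simp add: image_image)
qed

section \<open>Normal forms\<close>

text \<open>In one multidegree each generator carries a single monomial, so the leading term of a
  homogeneous vector is read off from the largest index with nonzero coefficient.\<close>

definition lead_idx :: "(nat \<Rightarrow> 'k::zero) set \<Rightarrow> nat set" where
  "lead_idx W = {i. \<exists>\<xi>\<in>W. \<xi> i \<noteq> 0 \<and> (\<forall>j>i. \<xi> j = 0)}"

definition unit_fun :: "nat \<Rightarrow> nat \<Rightarrow> 'k::zero_neq_one" where
  "unit_fun i j = (if j = i then 1 else 0)"

text \<open>Otherwise the largest index in the support of \<open>\<xi>\<close> would itself be a
  leading index.\<close>

lemma nonlead_eq_0: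
  fixes \<xi> :: "nat \<Rightarrow> 'k::zero"
  assumes "\<xi> \<in> W" "\<And>i. \<xi> i \<noteq> 0 \<Longrightarrow> i < s" "\<And>i. \<xi> i \<noteq> 0 \<Longrightarrow> i \<notin> lead_idx W"
  shows "\<xi> i = 0"
proof (rule ccontr)
  assume "\<xi> i \<noteq> 0"
  define m where "m = Max {i. \<xi> i \<noteq> 0}"
  have fin: "finite {i. \<xi> i \<noteq> 0}" using assms(2) by (auto intro: finite_subset[of _ "{..<s}"])
  hence "\<xi> m \<noteq> 0" unfolding m_def using Max_in[OF fin] \<open>\<xi> i \<noteq> 0\<close> by auto
  moreover have "\<xi> j = 0" if "j > m" for j
    using that Max_ge[OF fin, of j] unfolding m_def by (auto simp: not_le)
  ultimately have "m \<in> lead_idx W" using assms(1) by (auto simp: lead_idx_def)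
  with assms(3) \<open>\<xi> m \<noteq> 0\<close> show False by blast
qed

text \<open>Linear algebra model of one multidegree of the Cech complex. \<open>W F\<close> stands
  for the relations over the localization at \<open>F\<close>, written as coefficient vectors, and
  \<open>\<sigma> i\<close> for the variables that have to be inverted before generator
  \<open>i\<close> occurs in this degree. \<open>V F\<close> below models the free module, and
  \<open>std F\<close> indexes the standard monomials.\<close>

locale cech_filtration =
  fixes s :: nat
    and \<sigma> :: "nat \<Rightarrow> 'n::{finite,linorder} set"
    and W :: "'n set \<Rightarrow> (nat \<Rightarrow> 'k::field) set"
  assumes W_zero: "(\<lambda>i. 0) \<in> W F"
    and W_add: "\<xi> \<in> W F \<Longrightarrow> \<eta> \<in> W F \<Longrightarrow> (\<lambda>i. \<xi> i + \<eta> i) \<in> W F"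
    and W_scale: "\<xi> \<in> W F \<Longrightarrow> (\<lambda>i. a * \<xi> i) \<in> W F"
    and W_supp: "\<xi> \<in> W F \<Longrightarrow> \<xi> i \<noteq> 0 \<Longrightarrow> i < s \<and> \<sigma> i \<subseteq> F"
    and W_mono: "F \<subseteq> G \<Longrightarrow> W F \<subseteq> W G"
begin

definition V :: "'n set \<Rightarrow> (nat \<Rightarrow> 'k) set" where
  "V F = {\<xi>. \<forall>i. \<xi> i \<noteq> 0 \<longrightarrow> i < s \<and> \<sigma> i \<subseteq> F}"

definition std :: "'n set \<Rightarrow> nat set" where
  "std F = {i. i < s \<and> \<sigma> i \<subseteq> F \<and> i \<notin> lead_idx (W F)}"

lemma W_diff: "\<xi> \<in> W F \<Longrightarrow> \<eta> \<in> W F \<Longrightarrow> (\<lambda>i. \<xi> i - \<eta> i) \<in> W F"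
  using W_add[of \<xi> F "\<lambda>i. -1 * \<eta> i"] W_scale[of \<eta> F "-1"] by simp

lemma W_sum: "(\<And>x. x \<in> A \<Longrightarrow> f x \<in> W F) \<Longrightarrow> (\<lambda>i. \<Sum>x\<in>A. f x i) \<in> W F"
  by (induction A rule: infinite_finite_induct) (auto intro: W_add W_zero)

text \<open>Division from the top index down: an entry at a leading index is cancelled by a
  relation, any other entry is kept. The bound \<open>m\<close> is carried along because it yields
  the triangularity in \<open>red_le\<close>.\<close>

lemma normal_form_exists:
  "\<exists>\<rho>. (\<forall>j. \<rho> j \<noteq> 0 \<longrightarrow> j \<in> std F) \<and> (\<lambda>j. \<xi> j - \<rho> j) \<in> W F \<and> (\<forall>j\<ge>m. \<rho> j = 0)"
  if "\<xi> \<in> V F" "\<forall>j\<ge>m. \<xi> j = 0"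
  using that
proof (induction m arbitrary: \<xi>)
  case 0
  thus ?case using W_zero by (intro exI[of _ "\<lambda>_. 0"]) (auto simp: fun_eq_iff)
next
  case (Suc m)
  show ?case
  proof (cases "\<xi> m \<noteq> 0 \<and> m \<in> lead_idx (W F)")
    case True
    then obtain \<eta> where \<eta>: "\<eta> \<in> W F" "\<eta> m \<noteq> 0" "\<forall>j>m. \<eta> j = 0" by (auto simp: lead_idx_def)
    \<comment> \<open>The multiple of \<open>\<eta>\<close> cancels entry \<open>m\<close>, and both
      vectors vanish above \<open>m\<close>.\<close>
    define \<xi>' where "\<xi>' j = \<xi> j - \<xi> m / \<eta> m * \<eta> j" for j
    have e: "(\<lambda>j. \<xi> m / \<eta> m * \<eta> j) \<in> W F" by (rule W_scale[OF \<eta>(1)])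
    have "\<xi>' \<in> V F"
      unfolding V_def
    proof (intro CollectI allI impI)
      fix i assume "\<xi>' i \<noteq> 0"
      hence "\<xi> i \<noteq> 0 \<or> \<eta> i \<noteq> 0" by (auto simp: \<xi>'_def)
      thus "i < s \<and> \<sigma> i \<subseteq> F" using Suc.prems(1) W_supp[OF \<eta>(1)] by (auto simp: V_def)
    qed
    moreover have "\<forall>j\<ge>m. \<xi>' j = 0"
    proof (intro allI impI)
      fix j assume "j \<ge> m"
      thus "\<xi>' j = 0" using \<eta> Suc.prems(2) by (cases "j = m") (auto simp: \<xi>'_def)
    qed
    ultimately obtain \<rho> where \<rho>: "\<forall>j. \<rho> j \<noteq> 0 \<longrightarrow> j \<in> std F" "(\<lambda>j. \<xi>' j - \<rho> j) \<in> W F" "\<forall>j\<ge>m. \<rho> j = 0"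
      using Suc.IH by blast
    have "(\<lambda>j. \<xi> j - \<rho> j) \<in> W F"
      using W_add[OF \<rho>(2) e] by (simp add: \<xi>'_def)
    with \<rho> show ?thesis by (intro exI[of _ \<rho>]) auto
  next
    case False
    \<comment> \<open>Entry \<open>m\<close> is 0 or standard: it is set aside, the rest is reduced
      below \<open>m\<close>, and it is restored by \<open>\<rho>(m := \<xi> m)\<close>.\<close>
    define \<xi>' where "\<xi>' j = (if j = m then 0 else \<xi> j)" for j
    have "\<xi>' \<in> V F" "\<forall>j\<ge>m. \<xi>' j = 0"
      using Suc.prems by (auto simp: V_def \<xi>'_def Suc_le_eq)
    then obtain \<rho> where \<rho>: "\<forall>j. \<rho> j \<noteq> 0 \<longrightarrow> j \<in> std F" "(\<lambda>j. \<xi>' j - \<rho> j) \<in> W F" "\<forall>j\<ge>m. \<rho> j = 0"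
      using Suc.IH by blast
    have "(\<lambda>j. \<xi> j - (\<rho>(m := \<xi> m)) j) = (\<lambda>j. \<xi>' j - \<rho> j)"
      using \<rho>(3) by (auto simp: \<xi>'_def fun_eq_iff)
    moreover have "\<xi> m \<noteq> 0 \<longrightarrow> m \<in> std F"
      using False Suc.prems(1) by (auto simp: V_def std_def)
    ultimately show ?thesis using \<rho> by (intro exI[of _ "\<rho>(m := \<xi> m)"]) auto
  qed
qed

definition is_nf :: "'n set \<Rightarrow> (nat \<Rightarrow> 'k) \<Rightarrow> (nat \<Rightarrow> 'k) \<Rightarrow> bool" where
  "is_nf F \<xi> \<rho> \<longleftrightarrow> (\<forall>j. \<rho> j \<noteq> 0 \<longrightarrow> j \<in> std F) \<and> (\<lambda>j. \<xi> j - \<rho> j) \<in> W F"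

text \<open>The difference of two normal forms lies in \<open>W F\<close> and has no entry at a
  leading index, so it vanishes.\<close>

lemma is_nf_unique: "is_nf F \<xi> \<rho> \<Longrightarrow> is_nf F \<xi> \<rho>' \<Longrightarrow> \<rho> = \<rho>'"
proof
  fix i
  assume "is_nf F \<xi> \<rho>" "is_nf F \<xi> \<rho>'"
  hence *: "\<forall>j. \<rho> j \<noteq> 0 \<longrightarrow> j \<in> std F" "\<forall>j. \<rho>' j \<noteq> 0 \<longrightarrow> j \<in> std F"
    and W: "(\<lambda>j. \<xi> j - \<rho> j) \<in> W F" "(\<lambda>j. \<xi> j - \<rho>' j) \<in> W F"
    by (auto simp: is_nf_def)
  have "(\<lambda>j. \<rho>' j - \<rho> j) \<in> W F" using W_diff[OF W] by simp
  hence "\<rho>' i - \<rho> i = 0"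
    by (rule nonlead_eq_0[where s = s]) (use * in \<open>auto simp: std_def, (metis diff_self)+\<close>)
  thus "\<rho> i = \<rho>' i" by simp
qed

text \<open>The abstract counterpart of the reduction coefficients. The default 0, for a generator
  absent over \<open>F\<close>, makes \<open>red_in_std\<close> and \<open>red_le\<close> hold for
  every \<open>i\<close>.\<close>

definition red :: "'n set \<Rightarrow> nat \<Rightarrow> nat \<Rightarrow> 'k" where
  "red F i = (if i < s \<and> \<sigma> i \<subseteq> F then THE \<rho>. is_nf F (unit_fun i) \<rho> else (\<lambda>_. 0))"

lemma ex_nf: "i < s \<Longrightarrow> \<sigma> i \<subseteq> F \<Longrightarrow> \<exists>\<rho>. is_nf F (unit_fun i) \<rho> \<and> (\<forall>j>i. \<rho> j = 0)"
  using normal_form_exists[of "unit_fun i" F "Suc i"] unfolding is_nf_def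
  by (auto simp: V_def unit_fun_def Suc_le_eq)

lemma red_eqI: "i < s \<Longrightarrow> \<sigma> i \<subseteq> F \<Longrightarrow> is_nf F (unit_fun i) \<rho> \<Longrightarrow> red F i = \<rho>"
  unfolding red_def using is_nf_unique by auto

lemma red_nf: "i < s \<Longrightarrow> \<sigma> i \<subseteq> F \<Longrightarrow> is_nf F (unit_fun i) (red F i)"
  using ex_nf red_eqI by metis

lemma red_in_std: "red F i j \<noteq> 0 \<Longrightarrow> j \<in> std F"
  using red_nf[of i F] by (cases "i < s \<and> \<sigma> i \<subseteq> F") (auto simp: is_nf_def red_def)

lemma red_le: "red F i j \<noteq> 0 \<Longrightarrow> j \<le> i"
proof (cases "i < s \<and> \<sigma> i \<subseteq> F")
  case True
  then obtain \<rho> where "is_nf F (unit_fun i) \<rho>" "\<forall>j>i. \<rho> j = 0" using ex_nf by blast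
  thus "red F i j \<noteq> 0 \<Longrightarrow> j \<le> i" using red_eqI True by (metis not_le)
qed (auto simp: red_def)

lemma red_less: "i \<notin> std F \<Longrightarrow> red F i j \<noteq> 0 \<Longrightarrow> j < i"
  using red_le[of F i j] red_in_std[of F i j] by (metis le_neq_implies_less)

lemma red_std: "i \<in> std F \<Longrightarrow> red F i = unit_fun i"
  by (rule red_eqI) (auto simp: std_def is_nf_def unit_fun_def W_zero)

text \<open>The linear extension of \<open>red\<close> from the generators. Linearity is thus built
  in, and \<open>nf_is_nf\<close> recovers the characterization by \<open>is_nf\<close>.\<close>

definition nf :: "'n set \<Rightarrow> (nat \<Rightarrow> 'k) \<Rightarrow> nat \<Rightarrow> 'k" where
  "nf F \<xi> j = (\<Sum>i<s. \<xi> i * red F i j)"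

lemma nf_is_nf: "\<xi> \<in> V F \<Longrightarrow> is_nf F \<xi> (nf F \<xi>)"
proof -
  assume \<xi>: "\<xi> \<in> V F"
  have "(\<lambda>j. \<Sum>i<s. \<xi> i * (unit_fun i j - red F i j)) \<in> W F"
  proof (rule W_sum)
    fix i assume i: "i \<in> {..<s}"
    show "(\<lambda>j. \<xi> i * (unit_fun i j - red F i j)) \<in> W F"
    proof (cases "\<sigma> i \<subseteq> F")
      case True
      thus ?thesis using red_nf[of i F] i by (intro W_scale) (auto simp: is_nf_def)
    next
      case False
      hence "\<xi> i = 0" using \<xi> by (auto simp: V_def)
      thus ?thesis by (simp add: W_zero)
    qed
  qed
  also have "(\<lambda>j. \<Sum>i<s. \<xi> i * (unit_fun i j - red F i j)) = (\<lambda>j. \<xi> j - nf F \<xi> j)"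
  proof
    fix j
    have "(\<Sum>i<s. \<xi> i * unit_fun i j) = (if j < s then \<xi> j else 0)"
      by (simp add: unit_fun_def if_distrib cong: if_cong)
    also have "\<dots> = \<xi> j" using \<xi> by (auto simp: V_def)
    finally show "(\<Sum>i<s. \<xi> i * (unit_fun i j - red F i j)) = \<xi> j - nf F \<xi> j"
      by (simp add: nf_def right_diff_distrib sum_subtractf)
  qed
  finally have "(\<lambda>j. \<xi> j - nf F \<xi> j) \<in> W F" .
  moreover have "nf F \<xi> j \<noteq> 0 \<Longrightarrow> j \<in> std F" for j
    using red_in_std unfolding nf_def by (metis (no_types, lifting) mult_zero_right sum.neutral)
  ultimately show ?thesis by (simp add: is_nf_def)
qed

text \<open>This computes the kernel of \<open>nf\<close>, so the entries at \<open>std F\<close>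
  are coordinates on \<open>V F\<close> modulo \<open>W F\<close>.\<close>

lemma nf_eq_0_iff: "\<xi> \<in> V F \<Longrightarrow> (\<forall>j\<in>std F. nf F \<xi> j = 0) \<longleftrightarrow> \<xi> \<in> W F"
proof
  assume \<xi>: "\<xi> \<in> V F" "\<forall>j\<in>std F. nf F \<xi> j = 0"
  hence "nf F \<xi> = (\<lambda>_. 0)" using nf_is_nf[of \<xi> F] by (auto simp: is_nf_def fun_eq_iff)
  thus "\<xi> \<in> W F" using nf_is_nf[OF \<xi>(1)] by (simp add: is_nf_def)
next
  assume \<xi>: "\<xi> \<in> V F" "\<xi> \<in> W F"
  hence "is_nf F \<xi> (\<lambda>_. 0)" by (simp add: is_nf_def)
  hence "nf F \<xi> = (\<lambda>_. 0)" by (rule is_nf_unique[OF nf_is_nf[OF \<xi>(1)]])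
  thus "\<forall>j\<in>std F. nf F \<xi> j = 0" by simp
qed

end

section \<open>Signs and coboundaries\<close>

lemma t_sgn_square: "t_sgn \<sigma> F * t_sgn \<sigma> F = (1::'a::ring_1)"
  by (simp add: t_sgn_def flip: power_add mult_2)

lemma t_sgn_square': "t_sgn \<sigma> F * (t_sgn \<sigma> F * x) = (x::'a::ring_1)"
  by (metis mult.assoc mult_1_left t_sgn_square)

lemma t_sgn_divide: "x / t_sgn \<sigma> F = x * (t_sgn \<sigma> F :: 'a::field)"
  by (simp add: t_sgn_def minus_one_power_iff)

lemma t_sgn_nonzero [simp]: "t_sgn \<sigma> F \<noteq> (0 :: 'a::field)"
  by (simp add: t_sgn_def)

text \<open>The elements of \<open>\<sigma>\<close> below \<open>h\<close> are counted once on each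
  side: on the left in the rank of \<open>h\<close> in the union, on the right as the new pairs
  \<open>(a, h)\<close>. This converts Cech signs into simplicial signs.\<close>

lemma sgn_in_t_sgn:
  fixes h :: "'n::{finite,linorder}"
  assumes "\<tau> \<inter> \<sigma> = {}" "h \<notin> \<tau>" "h \<notin> \<sigma>"
  shows "t_sgn \<sigma> (\<tau> \<union> \<sigma>) * sgn_in h (insert h \<tau> \<union> \<sigma>)
         = (sgn_in h (insert h \<tau>) * t_sgn \<sigma> (insert h \<tau> \<union> \<sigma>) :: 'a::comm_ring_1)"
proof -
  have 1: "{m \<in> insert h \<tau> \<union> \<sigma>. m < h} = {m \<in> insert h \<tau>. m < h} \<union> {m \<in> \<sigma>. m < h}" by auto
  have c1: "card {m \<in> insert h \<tau> \<union> \<sigma>. m < h} = card {m \<in> insert h \<tau>. m < h} + card {m \<in> \<sigma>. m < h}"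
    unfolding 1 by (rule card_Un_disjoint) (use assms in auto)
  have 2: "{(a, b). a \<in> \<sigma> \<and> b \<in> insert h \<tau> \<union> \<sigma> - \<sigma> \<and> a < b} =
        {(a, b). a \<in> \<sigma> \<and> b \<in> \<tau> \<union> \<sigma> - \<sigma> \<and> a < b} \<union> (\<lambda>a. (a, h)) ` {m \<in> \<sigma>. m < h}"
    using assms by auto
  have c2: "card {(a, b). a \<in> \<sigma> \<and> b \<in> insert h \<tau> \<union> \<sigma> - \<sigma> \<and> a < b} =
        card {(a, b). a \<in> \<sigma> \<and> b \<in> \<tau> \<union> \<sigma> - \<sigma> \<and> a < b} + card {m \<in> \<sigma>. m < h}"
    unfolding 2 by (subst card_Un_disjoint) (use assms in \<open>auto simp: card_image inj_on_def\<close>)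
  show ?thesis unfolding t_sgn_def sgn_in_def c1 c2 by (simp add: power_add mult_ac)
qed

definition coboundary :: "('n::{finite,linorder} set \<Rightarrow> nat \<Rightarrow> 'k::comm_ring_1) \<Rightarrow> 'n set \<Rightarrow> nat \<Rightarrow> 'k" where
  "coboundary z G i = (\<Sum>k\<in>G. sgn_in k G * z (G - {k}) i)"

text \<open>Removing the smaller element lowers the rank of the larger one by 1; removing the larger
  one leaves the rank of the smaller unchanged.\<close>

lemma sgn_in_remove:
  fixes k m :: "'n::{finite,linorder}"
  assumes "k \<in> G" "m \<in> G" "k < m"
  shows "sgn_in k G * sgn_in m (G - {k}) = - (sgn_in m G * sgn_in k (G - {m}) :: 'a::comm_ring_1)"
proof -
  have 1: "{x \<in> G - {m}. x < k} = {x \<in> G. x < k}" using assms by auto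
  have 2: "{x \<in> G. x < m} = insert k {x \<in> G - {k}. x < m}" using assms by auto
  have "card {x \<in> G. x < m} = Suc (card {x \<in> G - {k}. x < m})"
    unfolding 2 by (rule card_insert_disjoint) auto
  thus ?thesis unfolding sgn_in_def 1 by simp
qed

lemma coboundary_coboundary: "coboundary (coboundary z) = 0"
proof (intro ext)
  fix G :: "'a set" and i
  define T where "T k m = sgn_in k G * (sgn_in m (G - {k}) * z (G - {k} - {m}) i)" for k m
  have T: "T k m = - T m k" if "k \<in> G" "m \<in> G" "k < m" for k m
    using sgn_in_remove[OF that, where 'a = 'b]
    by (simp add: T_def Diff_insert2[symmetric] insert_commute flip: mult.assoc)
  have T': "T k m = - T m k" if "k \<in> G" "m \<in> G" "k \<noteq> m" for k m
    using T[OF that(1,2)] T[OF that(2,1)] that(3) by (cases k m rule: linorder_cases) auto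
  have "coboundary (coboundary z) G i = (\<Sum>k\<in>G. \<Sum>m\<in>G - {k}. T k m)"
    by (simp add: coboundary_def T_def sum_distrib_left)
  \<comment> \<open>The pairs are split by their order. After renaming, the second half is the
    negative of the first by \<open>T'\<close>.\<close>
  also have "\<dots> = (\<Sum>k\<in>G. (\<Sum>m\<in>{m\<in>G. m < k}. T k m) + (\<Sum>m\<in>{m\<in>G. k < m}. T k m))"
    by (intro sum.cong refl, subst sum.union_disjoint[symmetric]) (auto intro!: sum.cong)
  also have "\<dots> = (\<Sum>k\<in>G. \<Sum>m\<in>{m\<in>G. m < k}. T k m) + (\<Sum>k\<in>G. \<Sum>m\<in>{m\<in>G. k < m}. T k m)"
    by (rule sum.distrib)
  also have "(\<Sum>k\<in>G. \<Sum>m\<in>{m\<in>G. k < m}. T k m) = (\<Sum>m\<in>G. \<Sum>k\<in>{k\<in>G. k < m}. T k m)"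
    by (rule sum.swap_restrict) auto
  also have "\<dots> = - (\<Sum>m\<in>G. \<Sum>k\<in>{k\<in>G. k < m}. T m k)"
    unfolding sum_negf[symmetric] by (intro sum.cong refl) (use T' in auto)
  finally show "coboundary (coboundary z) G i = 0 G i" by simp
qed

section \<open>The Cech complex of a filtered system of relations in normal form coordinates\<close>

context cech_filtration
begin

text \<open>The parameter \<open>X\<close> is instantiated with \<open>V\<close> for the free module
  and with \<open>W\<close> for its relations, which play the part of \<open>cech_cochains\<close>
  at the level of coefficients.\<close>

definition cochains :: "('n set \<Rightarrow> (nat \<Rightarrow> 'k) set) \<Rightarrow> int \<Rightarrow> ('n set \<Rightarrow> nat \<Rightarrow> 'k) set" where
  "cochains X p = {z. (\<forall>F. int (card F) = p \<longrightarrow> z F \<in> X F) \<and> (\<forall>F. int (card F) \<noteq> p \<longrightarrow> z F = 0)}"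

lemma V_zero: "(\<lambda>i. 0) \<in> V F"
  by (simp add: V_def)

lemma V_add: "\<xi> \<in> V F \<Longrightarrow> \<eta> \<in> V F \<Longrightarrow> (\<lambda>i. \<xi> i + \<eta> i) \<in> V F"
  unfolding V_def by (intro CollectI allI impI) (metis (mono_tags, lifting) add.right_neutral mem_Collect_eq)

lemma V_scale: "\<xi> \<in> V F \<Longrightarrow> (\<lambda>i. a * \<xi> i) \<in> V F"
  unfolding V_def by auto

lemma V_mono: "F \<subseteq> G \<Longrightarrow> V F \<subseteq> V G"
  unfolding V_def by blast

lemma V_diff: "\<xi> \<in> V F \<Longrightarrow> \<eta> \<in> V F \<Longrightarrow> (\<lambda>i. \<xi> i - \<eta> i) \<in> V F"
  using V_add[of \<xi> F "\<lambda>i. -1 * \<eta> i"] V_scale[of \<eta> F "-1"] by simp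

text \<open>The values are signed sums over faces \<open>G - {k}\<close>, so it suffices that each
  \<open>X F\<close> is a subspace and that \<open>X\<close> grows with \<open>F\<close>. This
  serves \<open>V\<close> and \<open>W\<close> alike.\<close>

lemma coboundary_cochains:
  assumes X: "\<And>F. (\<lambda>i. 0) \<in> X F" "\<And>F \<xi> \<eta>. \<xi> \<in> X F \<Longrightarrow> \<eta> \<in> X F \<Longrightarrow> (\<lambda>i. \<xi> i + \<eta> i) \<in> X F"
      "\<And>F \<xi> a. \<xi> \<in> X F \<Longrightarrow> (\<lambda>i. a * \<xi> i) \<in> X F" "\<And>F G. F \<subseteq> G \<Longrightarrow> X F \<subseteq> X G"
    and z: "z \<in> cochains X p"
  shows "coboundary z \<in> cochains X (p + 1)"
proof -
  have Xsum: "(\<lambda>i. \<Sum>x\<in>A. f x i) \<in> X F" if "\<And>x. x \<in> A \<Longrightarrow> f x \<in> X F" for A :: "'n set" and f F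
    using that by (induction A rule: infinite_finite_induct) (auto intro: X)
  show ?thesis
    unfolding cochains_def
  proof (intro CollectI conjI allI impI)
    fix G :: "'n set" assume "int (card G) = p + 1"
    hence "int (card (G - {k})) = p" if "k \<in> G" for k
      using that card_gt_0_iff[of G] by (auto simp: of_nat_diff)
    hence "z (G - {k}) \<in> X G" if "k \<in> G" for k
      using that z X(4)[of "G - {k}" G] by (auto simp: cochains_def)
    hence "(\<lambda>i. \<Sum>k\<in>G. sgn_in k G * z (G - {k}) i) \<in> X G" by (intro Xsum X(3))
    thus "coboundary z G \<in> X G" by (simp add: coboundary_def[abs_def])
  next
    fix G :: "'n set" assume G: "int (card G) \<noteq> p + 1"
    have "z (G - {k}) = 0" if "k \<in> G" for k
    proof -
      have "card G > 0" using that by (auto simp: card_gt_0_iff)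
      hence "int (card (G - {k})) \<noteq> p" using that G by (simp add: of_nat_diff)
      thus ?thesis using z by (simp add: cochains_def)
    qed
    thus "coboundary z G = 0" by (simp add: coboundary_def[abs_def] fun_eq_iff)
  qed
qed

lemma coboundary_V: "z \<in> cochains V p \<Longrightarrow> coboundary z \<in> cochains V (p + 1)"
  by (rule coboundary_cochains[where X = V]) (use V_mono in \<open>auto intro: V_zero V_add V_scale\<close>)

lemma coboundary_W: "z \<in> cochains W p \<Longrightarrow> coboundary z \<in> cochains W (p + 1)"
  by (rule coboundary_cochains[where X = W]) (use W_mono in \<open>auto intro: W_zero W_add W_scale\<close>)

text \<open>The normal form coordinates of a cochain. The coordinate of generator \<open>j\<close>
  over \<open>F\<close> is filed under the face \<open>F - \<sigma> j\<close>, and the sign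
  \<open>t_sgn\<close> is the change of basis that makes the differential come out as in the
  combinatorial complex.\<close>

definition to_L :: "('n set \<Rightarrow> nat \<Rightarrow> 'k) \<Rightarrow> (nat \<times> 'n set \<Rightarrow>\<^sub>0 'k)" where
  "to_L z = (\<Sum>F\<in>UNIV. \<Sum>j\<in>std F. Poly_Mapping.single (j, F - \<sigma> j) (t_sgn (\<sigma> j) F * nf F (z F) j))"

text \<open>A section of \<open>to_L\<close>: it picks the representatives that are already in
  normal form. The sign is its own inverse.\<close>

definition from_L :: "(nat \<times> 'n set \<Rightarrow>\<^sub>0 'k) \<Rightarrow> 'n set \<Rightarrow> nat \<Rightarrow> 'k" where
  "from_L f F i = (if i \<in> std F then t_sgn (\<sigma> i) F * Poly_Mapping.lookup f (i, F - \<sigma> i) else 0)"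

text \<open>Here \<open>p\<close> is the Cech degree, the size of the whole set
  \<open>F = \<tau> \<union> \<sigma> i\<close>, and not the simplicial degree of
  \<open>\<tau>\<close>.\<close>

definition L_idx :: "int \<Rightarrow> (nat \<times> 'n set) set" where
  "L_idx p = {(i, \<tau>). \<tau> \<inter> \<sigma> i = {} \<and> i \<in> std (\<tau> \<union> \<sigma> i) \<and> int (card (\<tau> \<union> \<sigma> i)) = p}"

definition L_sp :: "int \<Rightarrow> (nat \<times> 'n set \<Rightarrow>\<^sub>0 'k) set" where
  "L_sp p = {f. Poly_Mapping.keys f \<subseteq> L_idx p}"

lemma finite_std [simp]: "finite (std F)"
  by (rule finite_subset[of _ "{..<s}"]) (auto simp: std_def)

lemma lookup_to_L:
  "Poly_Mapping.lookup (to_L z) (i, \<tau>) =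
     (if \<tau> \<inter> \<sigma> i = {} \<and> i \<in> std (\<tau> \<union> \<sigma> i)
      then t_sgn (\<sigma> i) (\<tau> \<union> \<sigma> i) * nf (\<tau> \<union> \<sigma> i) (z (\<tau> \<union> \<sigma> i)) i else 0)" (is "_ = ?r")
proof -
  \<comment> \<open>For standard \<open>j\<close> the set \<open>F\<close> contains
    \<open>\<sigma> j\<close> and is recovered from \<open>F - \<sigma> j\<close>, so at most one
    term of the double sum contributes.\<close>
  have eq: "j \<in> std F \<Longrightarrow> j = i \<and> F - \<sigma> j = \<tau> \<longleftrightarrow> j = i \<and> F = \<tau> \<union> \<sigma> i \<and> \<tau> \<inter> \<sigma> i = {}" for j F
    by (auto simp: std_def)
  have "Poly_Mapping.lookup (to_L z) (i, \<tau>) =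
     (\<Sum>F\<in>UNIV. \<Sum>j\<in>std F. if j = i \<and> F = \<tau> \<union> \<sigma> i \<and> \<tau> \<inter> \<sigma> i = {} then t_sgn (\<sigma> j) F * nf F (z F) j else 0)"
    unfolding to_L_def by (simp add: lookup_sum lookup_single when_def eq cong: sum.cong)
  also have "\<dots> = (\<Sum>F\<in>{\<tau> \<union> \<sigma> i}. \<Sum>j\<in>std F. if j = i \<and> F = \<tau> \<union> \<sigma> i \<and> \<tau> \<inter> \<sigma> i = {} then t_sgn (\<sigma> j) F * nf F (z F) j else 0)"
    by (rule sum.mono_neutral_right) auto
  also have "\<dots> = ?r"
    by (cases "\<tau> \<inter> \<sigma> i = {}") simp_all
  finally show ?thesis .
qed

lemma nf_add: "nf F (\<lambda>i. \<xi> i + \<eta> i) j = nf F \<xi> j + nf F \<eta> j"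
  by (simp add: nf_def distrib_right sum.distrib)

lemma nf_scale: "nf F (\<lambda>i. a * \<xi> i) j = a * nf F \<xi> j"
  by (simp add: nf_def sum_distrib_left mult.assoc)

lemma nf_zero: "nf F 0 j = 0"
  by (simp add: nf_def)

lemma L_eqI:
  assumes "\<And>i \<tau>. Poly_Mapping.lookup f (i, \<tau>) = Poly_Mapping.lookup g (i, \<tau>)"
  shows "f = (g :: nat \<times> 'n set \<Rightarrow>\<^sub>0 'k)"
  using assms by (intro poly_mapping_eqI) auto

lemma lookup_L_scale [simp]: "Poly_Mapping.lookup (L_scale a f) b = a * Poly_Mapping.lookup f b" for a :: 'k
  by (simp add: L_scale_def Poly_Mapping.map.rep_eq when_def)

lemma to_L_add: "to_L (\<lambda>F i. z F i + y F i) = to_L z + to_L y"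
  by (rule L_eqI) (simp add: lookup_to_L lookup_add nf_add distrib_left)

lemma to_L_scale: "to_L (\<lambda>F i. a * z F i) = L_scale a (to_L z)"
  by (rule L_eqI) (simp add: lookup_to_L nf_scale mult_ac)

lemma to_L_diff: "to_L (\<lambda>F i. z F i - y F i) = to_L z - to_L y"
  using to_L_add[of z "\<lambda>F i. -1 * y F i"] to_L_scale[of "-1" y]
  by (simp add: poly_mapping_eq_iff fun_eq_iff lookup_add lookup_minus)

lemma from_L_add: "from_L (f + g) F i = from_L f F i + from_L g F i"
  by (simp add: from_L_def lookup_add distrib_left)

lemma from_L_scale: "from_L (L_scale a f) F i = a * from_L f F i"
  by (simp add: from_L_def mult_ac)

lemma to_L_cochains: "z \<in> cochains V p \<Longrightarrow> to_L z \<in> L_sp p"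
  unfolding L_sp_def
proof (intro CollectI subsetI)
  fix b assume z: "z \<in> cochains V p" and b: "b \<in> Poly_Mapping.keys (to_L z)"
  obtain i \<tau> where [simp]: "b = (i, \<tau>)" by force
  from b have *: "\<tau> \<inter> \<sigma> i = {}" "i \<in> std (\<tau> \<union> \<sigma> i)" "z (\<tau> \<union> \<sigma> i) \<noteq> 0"
    by (auto simp: in_keys_iff lookup_to_L nf_zero split: if_splits)
  with z show "b \<in> L_idx p" by (auto simp: L_idx_def cochains_def)
qed

text \<open>Every standard coordinate over every \<open>F\<close> appears in \<open>to_L z\<close>,
  so the claim reduces to \<open>nf_eq_0_iff\<close> for each \<open>F\<close> separately. Away from
  size \<open>p\<close> all values are 0, which lies in \<open>W F\<close>.\<close>

lemma to_L_eq_0_iff: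
  assumes z: "z \<in> cochains V p"
  shows "to_L z = 0 \<longleftrightarrow> z \<in> cochains W p"
proof -
  have "z F \<in> V F" for F
    using z V_zero by (cases "int (card F) = p") (auto simp: cochains_def zero_fun_def)
  hence iff: "z F \<in> W F \<longleftrightarrow> (\<forall>j\<in>std F. nf F (z F) j = 0)" for F using nf_eq_0_iff by blast
  have "to_L z = 0 \<longleftrightarrow> (\<forall>F. \<forall>j\<in>std F. nf F (z F) j = 0)"
  proof
    assume "to_L z = 0"
    show "\<forall>F. \<forall>j\<in>std F. nf F (z F) j = 0"
    proof (intro allI ballI)
      fix F j assume "j \<in> std F"
      moreover from this have "F - \<sigma> j \<union> \<sigma> j = F" "(F - \<sigma> j) \<inter> \<sigma> j = {}" by (auto simp: std_def)
      ultimately show "nf F (z F) j = 0"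
        using \<open>to_L z = 0\<close> lookup_to_L[of z j "F - \<sigma> j"] by simp
    qed
  qed (auto intro!: L_eqI simp: lookup_to_L)
  also have "\<dots> \<longleftrightarrow> (\<forall>F. z F \<in> W F)" by (simp add: iff)
  also have "\<dots> \<longleftrightarrow> z \<in> cochains W p"
  proof
    show "\<forall>F. z F \<in> W F \<Longrightarrow> z \<in> cochains W p" using z by (simp add: cochains_def)
    assume "z \<in> cochains W p"
    show "\<forall>F. z F \<in> W F"
    proof
      fix F show "z F \<in> W F" using \<open>z \<in> cochains W p\<close> W_zero[of F]
        by (cases "int (card F) = p") (auto simp: cochains_def zero_fun_def)
    qed
  qed
  finally show ?thesis .
qed

lemma from_L_cochains: "f \<in> L_sp p \<Longrightarrow> from_L f \<in> cochains V p"
proof -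
  assume f: "f \<in> L_sp p"
  have "from_L f F \<in> V F" for F by (auto simp: V_def from_L_def std_def)
  moreover have "from_L f F = 0" if "int (card F) \<noteq> p" for F
  proof
    fix i
    show "from_L f F i = 0 i"
    proof (cases "i \<in> std F")
      case True
      hence "F - \<sigma> i \<union> \<sigma> i = F" by (auto simp: std_def)
      hence "(i, F - \<sigma> i) \<notin> L_idx p" using that by (auto simp: L_idx_def)
      hence "Poly_Mapping.lookup f (i, F - \<sigma> i) = 0" using f by (auto simp: L_sp_def in_keys_iff)
      thus ?thesis by (simp add: from_L_def)
    qed (simp add: from_L_def)
  qed
  ultimately show ?thesis by (simp add: cochains_def)
qed

lemma nf_std:
  assumes "\<And>i. \<xi> i \<noteq> 0 \<Longrightarrow> i \<in> std F"
  shows "nf F \<xi> = \<xi>"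
proof -
  have "is_nf F \<xi> \<xi>" using assms W_zero by (simp add: is_nf_def)
  moreover have "\<xi> \<in> V F" using assms by (auto simp: V_def std_def)
  ultimately show ?thesis using is_nf_unique nf_is_nf by metis
qed

lemma to_L_from_L:
  assumes "f \<in> L_sp p"
  shows "to_L (from_L f) = f"
proof (rule L_eqI)
  fix i \<tau>
  have nf: "nf F (from_L f F) = from_L f F" for F
    by (rule nf_std) (auto simp: from_L_def split: if_splits)
  show "Poly_Mapping.lookup (to_L (from_L f)) (i, \<tau>) = Poly_Mapping.lookup f (i, \<tau>)"
  proof (cases "\<tau> \<inter> \<sigma> i = {} \<and> i \<in> std (\<tau> \<union> \<sigma> i)")
    case True
    hence "\<tau> \<union> \<sigma> i - \<sigma> i = \<tau>" by auto
    thus ?thesis using True by (simp add: lookup_to_L nf from_L_def t_sgn_square')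
  next
    case False
    hence "(i, \<tau>) \<notin> L_idx p" by (auto simp: L_idx_def)
    hence "Poly_Mapping.lookup f (i, \<tau>) = 0" using assms by (auto simp: L_sp_def in_keys_iff)
    with False show ?thesis by (auto simp: lookup_to_L)
  qed
qed

text \<open>The Cech differential transported to normal form coordinates: lift to representatives,
  differentiate, reduce again.\<close>

definition dL :: "(nat \<times> 'n set \<Rightarrow>\<^sub>0 'k) \<Rightarrow> (nat \<times> 'n set \<Rightarrow>\<^sub>0 'k)" where
  "dL f = to_L (coboundary (from_L f))"

lemma coboundary_add: "coboundary (\<lambda>F i. z F i + y F i) = (\<lambda>F i. coboundary z F i + coboundary y F i)"
  by (simp add: coboundary_def fun_eq_iff distrib_left sum.distrib)

lemma coboundary_diff: "coboundary (\<lambda>F i. z F i - y F i) = (\<lambda>F i. coboundary z F i - coboundary y F i)"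
  by (simp add: coboundary_def fun_eq_iff right_diff_distrib sum_subtractf)

lemma coboundary_scale: "coboundary (\<lambda>F i. a * z F i) = (\<lambda>F i. a * coboundary z F i)"
  by (simp add: coboundary_def fun_eq_iff sum_distrib_left mult_ac)

lemma dL_add: "dL (f + g) = dL f + dL g"
  by (simp add: dL_def from_L_add[abs_def] coboundary_add to_L_add)

lemma dL_scale: "dL (L_scale a f) = L_scale a (dL f)"
  by (simp add: dL_def from_L_scale[abs_def] coboundary_scale to_L_scale)

lemma dL_in_L_sp: "f \<in> L_sp p \<Longrightarrow> dL f \<in> L_sp (p + 1)"
  unfolding dL_def by (intro to_L_cochains coboundary_V from_L_cochains)

lemma cochains_V_diff: "z \<in> cochains V p \<Longrightarrow> y \<in> cochains V p \<Longrightarrow> (\<lambda>F i. z F i - y F i) \<in> cochains V p"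
  unfolding cochains_def by (auto intro: V_diff simp: zero_fun_def)

lemma to_L_eq_iff:
  assumes "z \<in> cochains V p" "y \<in> cochains V p"
  shows "to_L z = to_L y \<longleftrightarrow> (\<lambda>F i. z F i - y F i) \<in> cochains W p"
  using to_L_eq_0_iff[OF cochains_V_diff[OF assms]] by (simp add: to_L_diff)

text \<open>Independence of the representative: \<open>from_L (to_L z)\<close> and \<open>z\<close>
  differ by a cochain of relations, and the coboundary preserves such cochains.\<close>

lemma dL_to_L:
  assumes z: "z \<in> cochains V p"
  shows "dL (to_L z) = to_L (coboundary z)"
proof -
  have f: "from_L (to_L z) \<in> cochains V p" using z by (intro from_L_cochains to_L_cochains)
  have "to_L (from_L (to_L z)) = to_L z" using z by (intro to_L_from_L to_L_cochains)
  hence "(\<lambda>F i. from_L (to_L z) F i - z F i) \<in> cochains W p" using to_L_eq_iff[OF f z] by simp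
  from coboundary_W[OF this] show ?thesis
    unfolding dL_def coboundary_diff
    using to_L_eq_iff[OF coboundary_V[OF f] coboundary_V[OF z]] by simp
qed

lemma dL_dL: "f \<in> L_sp p \<Longrightarrow> dL (dL f) = 0"
proof -
  assume f: "f \<in> L_sp p"
  have "dL (dL f) = to_L (coboundary (coboundary (from_L f)))"
    unfolding dL_def[of f] using f by (intro dL_to_L[of _ "p + 1"] coboundary_V from_L_cochains)
  also have "\<dots> = 0"
    by (rule L_eqI) (simp add: coboundary_coboundary lookup_to_L nf_zero)
  finally show ?thesis .
qed

section \<open>The transported differential on basis elements\<close>

definition unit_cochain :: "'n set \<Rightarrow> nat \<Rightarrow> 'n set \<Rightarrow> nat \<Rightarrow> 'k" where
  "unit_cochain G i F j = (if F = G \<and> j = i then 1 else 0)"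

lemma to_L_unit_cochain:
  assumes "i < s"
  shows "to_L (unit_cochain G i) = (\<Sum>j\<in>std G. Poly_Mapping.single (j, G - \<sigma> j) (t_sgn (\<sigma> j) G * red G i j))"
proof -
  have nf: "nf F (unit_cochain G i F) j = (if F = G then red G i j else 0)" for F j
    using assms by (auto simp: nf_def unit_cochain_def if_distrib[of "\<lambda>x. x * _"] cong: if_cong)
  have "to_L (unit_cochain G i) =
    (\<Sum>F\<in>UNIV. if F = G then (\<Sum>j\<in>std F. Poly_Mapping.single (j, F - \<sigma> j) (t_sgn (\<sigma> j) F * red F i j)) else 0)"
    unfolding to_L_def by (intro sum.cong refl) (auto simp: nf)
  thus ?thesis by simp
qed

text \<open>The terms are indexed by the vertex \<open>h\<close> added to \<open>F\<close> instead
  of the vertex removed from \<open>G\<close>.\<close>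

lemma coboundary_unit_cochain:
  "coboundary (unit_cochain F i) = (\<lambda>G j. \<Sum>h\<in>-F. sgn_in h (insert h F) * unit_cochain (insert h F) i G j)"
proof (intro ext)
  fix G j
  have "coboundary (unit_cochain F i) G j = (\<Sum>k\<in>G. if k \<notin> F \<and> G = insert k F \<and> j = i then sgn_in k G else 0)"
    unfolding coboundary_def unit_cochain_def by (intro sum.cong refl) auto
  also have "\<dots> = (\<Sum>k\<in>UNIV. if k \<notin> F \<and> G = insert k F \<and> j = i then sgn_in k G else 0)"
    by (rule sum.mono_neutral_left) auto
  also have "\<dots> = (\<Sum>k\<in>-F. if k \<notin> F \<and> G = insert k F \<and> j = i then sgn_in k G else 0)"
    by (rule sum.mono_neutral_right) auto
  finally show "coboundary (unit_cochain F i) G j = (\<Sum>h\<in>-F. sgn_in h (insert h F) * unit_cochain (insert h F) i G j)"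
    by (auto simp: unit_cochain_def intro!: sum.cong)
qed

lemma to_L_sum: "finite A \<Longrightarrow> to_L (\<lambda>F i. \<Sum>x\<in>A. z x F i) = (\<Sum>x\<in>A. to_L (z x))"
proof (induction A rule: finite_induct)
  case empty
  show ?case by (rule L_eqI) (simp add: lookup_to_L nf_def)
qed (simp add: to_L_add)

lemma L_scale_single: "L_scale a (Poly_Mapping.single b x) = Poly_Mapping.single b (a * x)"
  by (simp add: L_scale_def map_single)

lemma L_scale_sum: "L_scale a (sum f A) = (\<Sum>x\<in>A. L_scale a (f x))" for a :: 'k
  by (rule poly_mapping_eqI) (simp add: lookup_sum sum_distrib_left)

text \<open>The Cech differential adds a vertex \<open>h\<close>. If generator \<open>i\<close> is
  still standard over the enlarged set, it is its own normal form; otherwise it is rewritten by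
  \<open>red\<close> through smaller generators.\<close>

lemma dL_single:
  assumes b: "(i, \<tau>) \<in> L_idx p"
  shows "dL (Poly_Mapping.single (i, \<tau>) 1) =
    (\<Sum>h\<in>- \<sigma> i - \<tau>. let G = insert h \<tau> \<union> \<sigma> i in
       if i \<in> std G then Poly_Mapping.single (i, insert h \<tau>) (sgn_in h (insert h \<tau>))
       else \<Sum>j<i. Poly_Mapping.single (j, G - \<sigma> j)
          (sgn_in h (insert h \<tau>) * red G i j * (t_sgn (\<sigma> i) G / t_sgn (\<sigma> j) G)))"
proof -
  define F where "F = \<tau> \<union> \<sigma> i"
  have i: "i < s" and F: "i \<in> std F" "\<tau> \<inter> \<sigma> i = {}" using b by (auto simp: L_idx_def std_def F_def)
  \<comment> \<open>The basis element lifts to generator \<open>i\<close> placed over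
    \<open>F\<close>, up to the sign of the change of basis.\<close>
  have "from_L (Poly_Mapping.single (i, \<tau>) 1) G j = t_sgn (\<sigma> i) F * unit_cochain F i G j" for G j
  proof -
    have "j \<in> std G \<Longrightarrow> (i, \<tau>) = (j, G - \<sigma> j) \<longleftrightarrow> G = F \<and> j = i"
      using F by (auto simp: F_def std_def)
    moreover have "\<not> (G = F \<and> j = i)" if "j \<notin> std G" using F that by auto
    ultimately show ?thesis by (auto simp: from_L_def lookup_single unit_cochain_def when_def)
  qed
  hence "from_L (Poly_Mapping.single (i, \<tau>) 1) = (\<lambda>G j. t_sgn (\<sigma> i) F * unit_cochain F i G j)"
    by (intro ext)
  hence "dL (Poly_Mapping.single (i, \<tau>) 1) = L_scale (t_sgn (\<sigma> i) F) (to_L (coboundary (unit_cochain F i)))"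
    by (simp add: dL_def coboundary_scale to_L_scale)
  also have "\<dots> = (\<Sum>h\<in>-F. L_scale (t_sgn (\<sigma> i) F * sgn_in h (insert h F)) (to_L (unit_cochain (insert h F) i)))"
    by (rule L_eqI) (simp add: coboundary_unit_cochain to_L_sum to_L_scale lookup_sum sum_distrib_left mult.assoc)
  also have "\<dots> = (\<Sum>h\<in>- \<sigma> i - \<tau>. let G = insert h \<tau> \<union> \<sigma> i in
       if i \<in> std G then Poly_Mapping.single (i, insert h \<tau>) (sgn_in h (insert h \<tau>))
       else \<Sum>j<i. Poly_Mapping.single (j, G - \<sigma> j)
          (sgn_in h (insert h \<tau>) * red G i j * (t_sgn (\<sigma> i) G / t_sgn (\<sigma> j) G)))"
  proof (intro sum.cong)
    fix h assume h: "h \<in> - \<sigma> i - \<tau>"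
    define G where "G = insert h \<tau> \<union> \<sigma> i"
    have G: "insert h F = G" by (auto simp: F_def G_def)
    \<comment> \<open>The Cech sign of \<open>h\<close> in \<open>G\<close> becomes its simplicial
      sign in \<open>insert h \<tau>\<close>, while the change of basis sign passes from
      \<open>F\<close> to \<open>G\<close>.\<close>
    have sg: "t_sgn (\<sigma> i) F * sgn_in h G = (sgn_in h (insert h \<tau>) * t_sgn (\<sigma> i) G :: 'k)"
      unfolding F_def G_def using h F by (intro sgn_in_t_sgn) auto
    have "L_scale (t_sgn (\<sigma> i) F * sgn_in h G) (to_L (unit_cochain G i)) =
      (\<Sum>j\<in>std G. Poly_Mapping.single (j, G - \<sigma> j) (sgn_in h (insert h \<tau>) * t_sgn (\<sigma> i) G * (t_sgn (\<sigma> j) G * red G i j)))"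
      by (simp add: sg to_L_unit_cochain[OF i] L_scale_sum L_scale_single)
    also have "\<dots> = (if i \<in> std G then Poly_Mapping.single (i, insert h \<tau>) (sgn_in h (insert h \<tau>))
       else \<Sum>j<i. Poly_Mapping.single (j, G - \<sigma> j)
          (sgn_in h (insert h \<tau>) * red G i j * (t_sgn (\<sigma> i) G / t_sgn (\<sigma> j) G)))"
    proof (cases "i \<in> std G")
      case True
      have "G - \<sigma> i = insert h \<tau>" using h F by (auto simp: G_def)
      hence "Poly_Mapping.single (i, G - \<sigma> i) (sgn_in h (insert h \<tau>) * t_sgn (\<sigma> i) G * (t_sgn (\<sigma> i) G * red G i i))
         = Poly_Mapping.single (i, insert h \<tau>) (sgn_in h (insert h \<tau>) :: 'k)"
        using True by (simp add: red_std unit_fun_def mult.assoc t_sgn_square)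
      moreover have "(\<Sum>j\<in>std G. Poly_Mapping.single (j, G - \<sigma> j) (sgn_in h (insert h \<tau>) * t_sgn (\<sigma> i) G * (t_sgn (\<sigma> j) G * red G i j)))
         = (\<Sum>j\<in>{i}. Poly_Mapping.single (j, G - \<sigma> j) (sgn_in h (insert h \<tau>) * t_sgn (\<sigma> i) G * (t_sgn (\<sigma> j) G * red G i j)))"
        by (rule sum.mono_neutral_right) (use True in \<open>auto simp: red_std unit_fun_def\<close>)
      ultimately show ?thesis using True by simp
    next
      case False
      \<comment> \<open>The coefficients vanish off \<open>std G\<close> and, as \<open>i\<close> is
        not standard, at every index not below \<open>i\<close>. Hence the sum over
        \<open>std G\<close> may be replaced by the sum over \<open>j < i\<close>.\<close>
      have red0': "red G i j = 0" if "j \<notin> std G" for j using red_in_std that by blast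
      have red0: "red G i j = 0" if "\<not> j < i" for j using red_less[OF False] that by blast
      have "(\<Sum>j\<in>std G. Poly_Mapping.single (j, G - \<sigma> j) (sgn_in h (insert h \<tau>) * t_sgn (\<sigma> i) G * (t_sgn (\<sigma> j) G * red G i j)))
         = (\<Sum>j\<in>std G \<inter> {..<i}. Poly_Mapping.single (j, G - \<sigma> j) (sgn_in h (insert h \<tau>) * t_sgn (\<sigma> i) G * (t_sgn (\<sigma> j) G * red G i j)))"
        by (rule sum.mono_neutral_right) (auto simp: red0)
      also have "\<dots> = (\<Sum>j<i. Poly_Mapping.single (j, G - \<sigma> j) (sgn_in h (insert h \<tau>) * t_sgn (\<sigma> i) G * (t_sgn (\<sigma> j) G * red G i j)))"
        by (rule sum.mono_neutral_left) (simp, blast, intro ballI, subst red0', auto)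
      finally show ?thesis using False by (simp add: t_sgn_divide mult_ac)
    qed
    finally show "L_scale (t_sgn (\<sigma> i) F * sgn_in h (insert h F)) (to_L (unit_cochain (insert h F) i)) =
      (let G = insert h \<tau> \<union> \<sigma> i in
       if i \<in> std G then Poly_Mapping.single (i, insert h \<tau>) (sgn_in h (insert h \<tau>))
       else \<Sum>j<i. Poly_Mapping.single (j, G - \<sigma> j)
          (sgn_in h (insert h \<tau>) * red G i j * (t_sgn (\<sigma> i) G / t_sgn (\<sigma> j) G)))"
      unfolding G Let_def G_def[symmetric] .
  qed (auto simp: F_def)
  finally show ?thesis .
qed

end

section \<open>Graded components of localizations\<close>

lemma lookup_single_mult_add:
  fixes p :: "'a::cancel_comm_monoid_add \<Rightarrow>\<^sub>0 'b::comm_ring_1"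
  shows "Poly_Mapping.lookup (Poly_Mapping.single u x * p) (u + d) = x * Poly_Mapping.lookup p d"
  by (simp add: lookup_mult lookup_single when_mult)

lemma single_sum: "(\<Sum>j\<in>A. Poly_Mapping.single u (f j)) = Poly_Mapping.single u (\<Sum>j\<in>A. f j)"
  by (induction A rule: infinite_finite_induct) (simp_all add: single_add)

lemma lookup_to_int_vec [simp]: "Poly_Mapping.lookup (to_int_vec u) k = int (Poly_Mapping.lookup u k)"
  by (simp add: to_int_vec_def Poly_Mapping.map.rep_eq when_def)

lemma to_int_vec_add: "to_int_vec (u + v) = to_int_vec u + to_int_vec v"
  by (rule poly_mapping_eqI) (simp add: lookup_add)

lemma to_int_vec_eq_iff [simp]: "to_int_vec u = to_int_vec v \<longleftrightarrow> u = v"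
  by (simp add: poly_mapping_eq_iff fun_eq_iff)

lemma to_int_vec_diff:
  assumes "\<And>k. Poly_Mapping.lookup v k \<le> Poly_Mapping.lookup u k"
  shows "to_int_vec (u - v) = to_int_vec u - to_int_vec v"
  by (rule poly_mapping_eqI) (simp add: lookup_minus assms of_nat_diff)

lemma lookup_pos_part: "Poly_Mapping.lookup (pos_part d) k = nat (Poly_Mapping.lookup d k)"
  by (simp add: pos_part_def Poly_Mapping.map.rep_eq when_def)

lemma lookup_neg_part: "Poly_Mapping.lookup (neg_part d) k = nat (- Poly_Mapping.lookup d k)"
  by (simp add: neg_part_def Poly_Mapping.map.rep_eq when_def)

lemma to_int_vec_pos_part:
  assumes "\<And>k. Poly_Mapping.lookup d k \<ge> 0"
  shows "to_int_vec (pos_part d) = d"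
  by (rule poly_mapping_eqI) (simp add: lookup_pos_part assms)

lemma lookup_indicator_vec:
  "Poly_Mapping.lookup (indicator_vec L) k = (if k \<in> L then 1 else 0)" for L :: "'n::finite set"
  by (simp add: indicator_vec_def lookup_sum lookup_single when_def)

lemma lookup_to_laurent: "Poly_Mapping.lookup (to_laurent p) (to_int_vec u) = Poly_Mapping.lookup p u"
proof -
  have "Poly_Mapping.lookup (to_laurent p) (to_int_vec u) =
      (\<Sum>v\<in>Poly_Mapping.keys p. if v = u then Poly_Mapping.lookup p v else 0)"
    by (simp add: to_laurent_def lookup_sum lookup_single when_def)
  thus ?thesis by (simp add: in_keys_iff)
qed

lemma lookup_to_laurent_range:
  assumes "Poly_Mapping.lookup (to_laurent p) d \<noteq> 0"
  obtains u where "d = to_int_vec u"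
proof -
  from assms obtain v where "Poly_Mapping.lookup (Poly_Mapping.single (to_int_vec v) (Poly_Mapping.lookup p v)) d \<noteq> 0"
    unfolding to_laurent_def lookup_sum by (meson sum.neutral)
  thus ?thesis using that by (auto simp: lookup_single when_def split: if_splits)
qed

lemma laurent_eqI:
  fixes f g :: "('n, 'k::comm_ring_1) laurent_ring"
  assumes "\<And>u. Poly_Mapping.lookup f (to_int_vec u) = Poly_Mapping.lookup g (to_int_vec u)"
    and "\<And>d. d \<notin> range to_int_vec \<Longrightarrow> Poly_Mapping.lookup f d = Poly_Mapping.lookup g d"
  shows "f = g"
proof (rule poly_mapping_eqI)
  fix d show "Poly_Mapping.lookup f d = Poly_Mapping.lookup g d"
    using assms by (cases "d \<in> range to_int_vec") auto
qed

lemma lookup_to_laurent_notin: "d \<notin> range to_int_vec \<Longrightarrow> Poly_Mapping.lookup (to_laurent p) d = 0"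
  using lookup_to_laurent_range by (metis rangeI)

lemma to_laurent_0 [simp]: "to_laurent 0 = 0"
  by (simp add: to_laurent_def)

lemma to_laurent_add: "to_laurent (p + q) = to_laurent p + to_laurent q"
  by (rule laurent_eqI) (simp_all add: lookup_to_laurent lookup_to_laurent_notin lookup_add)

lemma to_laurent_sum: "to_laurent (sum f A) = (\<Sum>x\<in>A. to_laurent (f x))"
  by (induction A rule: infinite_finite_induct) (simp_all add: to_laurent_add)

lemma to_laurent_eq_iff: "to_laurent p = to_laurent q \<longleftrightarrow> p = q"
  by (metis lookup_to_laurent poly_mapping_eqI)

lemma to_laurent_single: "to_laurent (Poly_Mapping.single u x) = Poly_Mapping.single (to_int_vec u) x"
  by (simp add: to_laurent_def)

lemma to_laurent_single_mult:
  "to_laurent (Poly_Mapping.single u x * p) = Poly_Mapping.single (to_int_vec u) x * to_laurent p"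
proof (rule poly_mapping_eqI)
  fix d
  have R: "Poly_Mapping.lookup (Poly_Mapping.single (to_int_vec u) x * to_laurent p) d =
      x * Poly_Mapping.lookup (to_laurent p) (d - to_int_vec u)"
    using lookup_single_mult_add[of "to_int_vec u" x "to_laurent p" "d - to_int_vec u"] by simp
  show "Poly_Mapping.lookup (to_laurent (Poly_Mapping.single u x * p)) d =
      Poly_Mapping.lookup (Poly_Mapping.single (to_int_vec u) x * to_laurent p) d"
  \<comment> \<open>The range of \<open>to_int_vec\<close> consists of the nonnegative vectors. If
    \<open>d - to_int_vec u\<close> is not among them, the coefficient at \<open>d\<close> is 0 on
    both sides.\<close>
  proof (cases "d - to_int_vec u \<in> range to_int_vec")
    case True
    then obtain v where "d - to_int_vec u = to_int_vec v" by auto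
    hence v: "d - to_int_vec u = to_int_vec v" and d: "d = to_int_vec (u + v)"
      by (simp_all add: to_int_vec_add algebra_simps)
    show ?thesis unfolding R v unfolding d lookup_to_laurent lookup_single_mult_add ..
  next
    case False
    have "Poly_Mapping.lookup (to_laurent (Poly_Mapping.single u x * p)) d = 0"
    proof (rule ccontr)
      assume nz: "\<not> ?thesis"
      then obtain e where e: "d = to_int_vec e" by (rule lookup_to_laurent_range)
      with nz have "e \<in> Poly_Mapping.keys (Poly_Mapping.single u x * p)"
        by (simp add: lookup_to_laurent in_keys_iff)
      with keys_mult[of "Poly_Mapping.single u x" p]
      obtain w v where "w \<in> Poly_Mapping.keys (Poly_Mapping.single u x)" "e = w + v" by blast
      hence "e = u + v" by (auto split: if_splits)
      with e False show False by (auto simp: to_int_vec_add)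
    qed
    thus ?thesis using R False by (simp add: lookup_to_laurent_notin)
  qed
qed

lemma var_prod_power:
  "var_prod F ^ t = Poly_Mapping.single (\<Sum>i\<in>F. Poly_Mapping.single i (of_nat t :: 'e::comm_semiring_1)) (1::'k::comm_ring_1)"
proof -
  have "var_prod F = Poly_Mapping.single (\<Sum>i\<in>F. Poly_Mapping.single i (1::'e)) (1::'k)"
    unfolding var_prod_def var_def
    by (induction F rule: infinite_finite_induct) (simp_all add: mult_single)
  moreover have "Poly_Mapping.single (\<Sum>i\<in>F. Poly_Mapping.single i (1::'e)) (1::'k) ^ t
    = Poly_Mapping.single (\<Sum>i\<in>F. Poly_Mapping.single i (of_nat t)) 1"
    by (induction t) (simp_all add: mult_single single_add sum.distrib)
  ultimately show ?thesis by simp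
qed

text \<open>The exponent of the \<open>t\<close>-th power of the product of the variables in
  \<open>F\<close>.\<close>

definition localize_shift :: "'n set \<Rightarrow> nat \<Rightarrow> ('n \<Rightarrow>\<^sub>0 int)" where
  "localize_shift F t = (\<Sum>i\<in>F. Poly_Mapping.single i (int t))"

lemma lookup_localize_shift:
  "Poly_Mapping.lookup (localize_shift F t) k = (if k \<in> F then int t else 0)" for F :: "'n::finite set"
  by (simp add: localize_shift_def lookup_sum lookup_single when_def)

lemma localized_iff:
  "w \<in> localized F P \<longleftrightarrow>
     (\<exists>t. \<exists>m\<in>P. \<forall>i. Poly_Mapping.single (localize_shift F t) 1 * w i = to_laurent (m i))"
  by (simp add: localized_def var_prod_power localize_shift_def)

text \<open>Equivalently, \<open>x\<^bsup>\<alpha> - u\<^esup>\<close> lies in the localization of the polynomial ring at \<open>x\<^sub>F\<close>.\<close>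

definition deg_le_outside :: "'n set \<Rightarrow> ('n \<Rightarrow>\<^sub>0 int) \<Rightarrow> ('n \<Rightarrow>\<^sub>0 nat) \<Rightarrow> bool" where
  "deg_le_outside F \<alpha> u \<longleftrightarrow> (\<forall>k. k \<notin> F \<longrightarrow> int (Poly_Mapping.lookup u k) \<le> Poly_Mapping.lookup \<alpha> k)"

lemma deg_le_outside_empty:
  "deg_le_outside {} (to_int_vec b) u \<longleftrightarrow> (\<forall>k. Poly_Mapping.lookup u k \<le> Poly_Mapping.lookup b k)"
  by (simp add: deg_le_outside_def)

text \<open>The entries of \<open>u\<close> are 0 or 1 and \<alpha> is a nonnegative integer outside
  \<open>F\<close>, so each inequality only asks whether \<alpha> is positive where \<open>u\<close>
  is nonzero. This is how squarefreeness makes the relations depend on supports alone.\<close>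

lemma deg_le_outside_squarefree:
  assumes "squarefree_vec u" "\<And>k. k \<notin> F \<Longrightarrow> Poly_Mapping.lookup \<alpha> k \<ge> 0"
  shows "deg_le_outside F \<alpha> u \<longleftrightarrow> Poly_Mapping.keys u \<subseteq> F \<union> {k. Poly_Mapping.lookup \<alpha> k > 0}"
proof -
  have "k \<notin> F \<Longrightarrow> int (Poly_Mapping.lookup u k) \<le> Poly_Mapping.lookup \<alpha> k \<longleftrightarrow>
     (k \<in> Poly_Mapping.keys u \<longrightarrow> 0 < Poly_Mapping.lookup \<alpha> k)" for k
    using assms(1)[unfolded squarefree_vec_def, rule_format, of k] assms(2)[of k] by (auto simp: in_keys_iff)
  thus ?thesis unfolding deg_le_outside_def by blast
qed

lemma deg_le_outside_mono:
  "deg_le_outside F \<alpha> u \<Longrightarrow> F \<subseteq> G \<Longrightarrow> (\<And>k. Poly_Mapping.lookup \<alpha> k \<le> Poly_Mapping.lookup \<alpha>' k) \<Longrightarrow> deg_le_outside G \<alpha>' u"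
  unfolding deg_le_outside_def by (meson order_trans subsetD)

section \<open>Homogeneous components of the localized relation module\<close>

locale squarefree_presentation =
  fixes s l :: nat
    and c :: "nat \<Rightarrow> nat \<Rightarrow> 'k::field"
    and a :: "nat \<Rightarrow> nat \<Rightarrow> ('n::{finite,linorder} \<Rightarrow>\<^sub>0 nat)"
    and \<gamma> \<beta> :: "nat \<Rightarrow> ('n \<Rightarrow>\<^sub>0 nat)"
    and leq :: "('n \<Rightarrow>\<^sub>0 nat) \<Rightarrow> ('n \<Rightarrow>\<^sub>0 nat) \<Rightarrow> bool"
  assumes sol: "squarefree_solution s l c a \<gamma> \<beta>"
    and mon: "monomial_order leq"
begin

abbreviation N :: "(nat \<Rightarrow> ('n, 'k) poly_ring) set" where
  "N \<equiv> column_module (monomial_matrix s l c a)"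

definition W :: "'n set \<Rightarrow> ('n \<Rightarrow>\<^sub>0 int) \<Rightarrow> (nat \<Rightarrow> 'k) set" where
  "W F \<alpha> = {\<xi>. \<exists>\<eta>. (\<forall>j<l. \<eta> j \<noteq> 0 \<longrightarrow> deg_le_outside F \<alpha> (\<gamma> j)) \<and>
     (\<forall>i. \<xi> i = (if i < s then \<Sum>j<l. c i j * \<eta> j else 0))}"

lemma degree_eq: "i < s \<Longrightarrow> j < l \<Longrightarrow> c i j \<noteq> 0 \<Longrightarrow> to_int_vec (\<gamma> j) = to_int_vec (a i j) + to_int_vec (\<beta> i)"
  using sol by (simp add: squarefree_solution_def algebra_simps)

lemma sqfree: "j < l \<Longrightarrow> squarefree_vec (\<gamma> j)" "i < s \<Longrightarrow> squarefree_vec (\<beta> i)"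
  using sol by (simp_all add: squarefree_solution_def)

lemma N_iff: "m \<in> N \<longleftrightarrow> (\<exists>w. \<forall>i. m i = (if i < s then \<Sum>j<l. Poly_Mapping.single (a i j) (c i j) * w j else 0))"
  unfolding column_module_def by (auto simp: monomial_matrix_def fun_eq_iff image_iff intro!: ex_cong1)

lemma W_zero: "(\<lambda>i. 0) \<in> W F \<alpha>"
  unfolding W_def by (intro CollectI exI[of _ "\<lambda>_. 0"]) simp

lemma W_add: "\<xi> \<in> W F \<alpha> \<Longrightarrow> \<xi>' \<in> W F \<alpha> \<Longrightarrow> (\<lambda>i. \<xi> i + \<xi>' i) \<in> W F \<alpha>"
proof -
  assume "\<xi> \<in> W F \<alpha>" "\<xi>' \<in> W F \<alpha>"
  then obtain \<eta> \<eta>' where \<eta>: "\<forall>j<l. \<eta> j \<noteq> 0 \<longrightarrow> deg_le_outside F \<alpha> (\<gamma> j)" "\<forall>j<l. \<eta>' j \<noteq> 0 \<longrightarrow> deg_le_outside F \<alpha> (\<gamma> j)"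
    and \<xi>: "\<forall>i. \<xi> i = (if i < s then \<Sum>j<l. c i j * \<eta> j else 0)" "\<forall>i. \<xi>' i = (if i < s then \<Sum>j<l. c i j * \<eta>' j else 0)"
    unfolding W_def by blast
  have "\<forall>j<l. \<eta> j + \<eta>' j \<noteq> 0 \<longrightarrow> deg_le_outside F \<alpha> (\<gamma> j)" using \<eta> by (metis add_0)
  thus ?thesis unfolding W_def using \<xi>
    by (intro CollectI exI[of _ "\<lambda>j. \<eta> j + \<eta>' j"]) (simp add: distrib_left sum.distrib)
qed

lemma W_scale: "\<xi> \<in> W F \<alpha> \<Longrightarrow> (\<lambda>i. x * \<xi> i) \<in> W F \<alpha>"
proof -
  assume "\<xi> \<in> W F \<alpha>"
  then obtain \<eta> where "\<forall>j<l. \<eta> j \<noteq> 0 \<longrightarrow> deg_le_outside F \<alpha> (\<gamma> j)"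
    "\<forall>i. \<xi> i = (if i < s then \<Sum>j<l. c i j * \<eta> j else 0)" unfolding W_def by blast
  thus ?thesis unfolding W_def
    by (intro CollectI exI[of _ "\<lambda>j. x * \<eta> j"]) (simp add: sum_distrib_left mult_ac)
qed

text \<open>Where \<open>c i j\<close> is nonzero, \<open>\<gamma> j\<close> exceeds
  \<open>\<beta> i\<close> by the exponent of a matrix entry, hence dominates it
  componentwise.\<close>

lemma deg_le_row: "i < s \<Longrightarrow> j < l \<Longrightarrow> c i j \<noteq> 0 \<Longrightarrow> deg_le_outside F \<alpha> (\<gamma> j) \<Longrightarrow> deg_le_outside F \<alpha> (\<beta> i)"
  unfolding deg_le_outside_def
proof (intro allI impI)
  fix k assume *: "i < s" "j < l" "c i j \<noteq> 0" "k \<notin> F"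
    and le: "\<forall>k. k \<notin> F \<longrightarrow> int (Poly_Mapping.lookup (\<gamma> j) k) \<le> Poly_Mapping.lookup \<alpha> k"
  have "Poly_Mapping.lookup (to_int_vec (\<gamma> j)) k = Poly_Mapping.lookup (to_int_vec (a i j) + to_int_vec (\<beta> i)) k"
    using degree_eq[OF *(1-3)] by simp
  with le * show "int (Poly_Mapping.lookup (\<beta> i) k) \<le> Poly_Mapping.lookup \<alpha> k" by (auto simp: lookup_add)
qed

lemma W_supp:
  assumes "\<xi> \<in> W F \<alpha>" "\<xi> i \<noteq> 0"
  shows "i < s \<and> deg_le_outside F \<alpha> (\<beta> i)"
proof -
  obtain \<eta> where \<eta>: "\<forall>j<l. \<eta> j \<noteq> 0 \<longrightarrow> deg_le_outside F \<alpha> (\<gamma> j)"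
    "\<forall>i. \<xi> i = (if i < s then \<Sum>j<l. c i j * \<eta> j else 0)" using assms(1) unfolding W_def by blast
  hence i: "i < s" "(\<Sum>j<l. c i j * \<eta> j) \<noteq> 0" using assms(2) by (auto split: if_splits)
  then obtain j where "j < l" "c i j * \<eta> j \<noteq> 0" by (meson lessThan_iff sum.neutral)
  thus ?thesis using \<eta> i deg_le_row by auto
qed

lemma W_mono:
  assumes "\<And>j. j < l \<Longrightarrow> deg_le_outside F \<alpha> (\<gamma> j) \<Longrightarrow> deg_le_outside G \<alpha>' (\<gamma> j)"
  shows "W F \<alpha> \<subseteq> W G \<alpha>'"
  unfolding W_def using assms by blast

text \<open>By \<open>deg_le_outside_squarefree\<close> both sides admit the columns whose degree is
  supported in \<open>keys b\<close>. Degrees of a localization can thus be traded for degrees in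
  \<nat>^n, where initial ideals live.\<close>

lemma W_eq_support:
  assumes "\<And>k. k \<notin> F \<Longrightarrow> Poly_Mapping.lookup \<alpha> k \<ge> 0"
    and "Poly_Mapping.keys b = F \<union> {k. Poly_Mapping.lookup \<alpha> k > 0}"
  shows "W {} (to_int_vec b) = W F \<alpha>"
proof -
  have "{k. Poly_Mapping.lookup (to_int_vec b) k > 0} = Poly_Mapping.keys b" by (auto simp: in_keys_iff)
  hence "deg_le_outside {} (to_int_vec b) (\<gamma> j) \<longleftrightarrow> deg_le_outside F \<alpha> (\<gamma> j)" if "j < l" for j
    using that assms by (simp add: deg_le_outside_squarefree sqfree)
  thus ?thesis by (intro equalityI W_mono) simp_all
qed

lemma localized_N_component:
  assumes "w \<in> localized F N"
  shows "(\<lambda>i. Poly_Mapping.lookup (w i) (\<alpha> - to_int_vec (\<beta> i))) \<in> W F \<alpha>"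
proof -
  from assms obtain t m where "m \<in> N"
    and w: "\<And>i. Poly_Mapping.single (localize_shift F t) 1 * w i = to_laurent (m i)"
    unfolding localized_iff by blast
  then obtain w0 where m: "\<And>i. m i = (if i < s then \<Sum>j<l. Poly_Mapping.single (a i j) (c i j) * w0 j else 0)"
    unfolding N_iff by blast
  define b where "b = localize_shift F t + \<alpha>"
  \<comment> \<open>After clearing denominators, the coefficient of the \<open>j\<close>-th
    multiplier in degree \<open>b - \<gamma> j\<close> is taken. By \<open>degree_eq\<close> every
    row with a nonzero entry in column \<open>j\<close> selects this same coefficient.\<close>
  define \<eta> where "\<eta> j = Poly_Mapping.lookup (to_laurent (w0 j)) (b - to_int_vec (\<gamma> j))" for j
  have "Poly_Mapping.lookup (w i) (\<alpha> - to_int_vec (\<beta> i)) = (if i < s then \<Sum>j<l. c i j * \<eta> j else 0)" for i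
  proof -
    have "Poly_Mapping.lookup (w i) (\<alpha> - to_int_vec (\<beta> i)) = Poly_Mapping.lookup (to_laurent (m i)) (b - to_int_vec (\<beta> i))"
      using lookup_single_mult_add[of "localize_shift F t" 1 "w i" "\<alpha> - to_int_vec (\<beta> i)"] w[of i]
      by (simp add: b_def algebra_simps)
    also have "\<dots> = (if i < s then \<Sum>j<l. c i j * \<eta> j else 0)"
    proof (cases "i < s")
      case True
      have "Poly_Mapping.lookup (Poly_Mapping.single (to_int_vec (a i j)) (c i j) * to_laurent (w0 j)) (b - to_int_vec (\<beta> i)) = c i j * \<eta> j"
        if "j < l" for j
      proof (cases "c i j = 0")
        case False
        have "b - to_int_vec (\<beta> i) = to_int_vec (a i j) + (b - to_int_vec (\<gamma> j))"
          using degree_eq[OF True that False] by simp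
        thus ?thesis by (simp only: lookup_single_mult_add \<eta>_def)
      qed simp
      thus ?thesis using True by (simp add: m to_laurent_sum to_laurent_single_mult lookup_sum)
    qed (simp add: m)
    finally show ?thesis .
  qed
  \<comment> \<open>A nonzero coefficient of a polynomial forces \<open>b - \<gamma> j\<close> to be
    nonnegative, and \<open>b\<close> agrees with \<alpha> outside \<open>F\<close>.\<close>
  moreover have "deg_le_outside F \<alpha> (\<gamma> j)" if "\<eta> j \<noteq> 0" for j
    unfolding deg_le_outside_def
  proof (intro allI impI)
    fix k assume k: "k \<notin> F"
    from that obtain u where "b - to_int_vec (\<gamma> j) = to_int_vec u"
      unfolding \<eta>_def by (rule lookup_to_laurent_range)
    from arg_cong[OF this, of "\<lambda>x. Poly_Mapping.lookup x k"] k
    show "int (Poly_Mapping.lookup (\<gamma> j) k) \<le> Poly_Mapping.lookup \<alpha> k"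
      by (simp add: b_def lookup_minus lookup_add lookup_localize_shift)
  qed
  ultimately show ?thesis unfolding W_def by blast
qed

lemma ex_shift:
  fixes F :: "'n set"
  shows "\<exists>t. \<forall>u. deg_le_outside F \<alpha> u \<and> (squarefree_vec u) \<longrightarrow>
    (\<forall>k. Poly_Mapping.lookup (localize_shift F t + \<alpha> - to_int_vec u) k \<ge> 0)"
proof (intro exI allI impI)
  \<comment> \<open>The sum bounds every negative entry of \<alpha>, and the extra 1 absorbs an
    entry of a squarefree vector. One \<open>t\<close> therefore works for all \<open>u\<close> at
    once.\<close>
  define t where "t = nat (\<Sum>k\<in>UNIV. \<bar>Poly_Mapping.lookup \<alpha> k\<bar>) + 1"
  fix u :: "'n \<Rightarrow>\<^sub>0 nat" and k assume u: "deg_le_outside F \<alpha> u \<and> squarefree_vec u"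
  have "\<bar>Poly_Mapping.lookup \<alpha> k\<bar> \<le> (\<Sum>k\<in>UNIV. \<bar>Poly_Mapping.lookup \<alpha> k\<bar>)"
    by (rule member_le_sum) auto
  moreover have "Poly_Mapping.lookup u k \<le> 1" using u by (auto simp: squarefree_vec_def dest: spec[of _ k])
  ultimately have "int t + Poly_Mapping.lookup \<alpha> k \<ge> Poly_Mapping.lookup u k" unfolding t_def by linarith
  thus "Poly_Mapping.lookup (localize_shift F (nat (\<Sum>k\<in>UNIV. \<bar>Poly_Mapping.lookup \<alpha> k\<bar>) + 1) + \<alpha> - to_int_vec u) k \<ge> 0"
    using u unfolding t_def[symmetric] deg_le_outside_def by (simp add: lookup_minus lookup_add lookup_localize_shift)
qed

lemma localized_N_monomials:
  assumes "\<xi> \<in> W F \<alpha>"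
  shows "(\<lambda>i. Poly_Mapping.single (\<alpha> - to_int_vec (\<beta> i)) (\<xi> i)) \<in> localized F N"
proof -
  obtain \<eta> where \<eta>: "\<And>j. j < l \<Longrightarrow> \<eta> j \<noteq> 0 \<Longrightarrow> deg_le_outside F \<alpha> (\<gamma> j)"
    and \<xi>: "\<And>i. \<xi> i = (if i < s then \<Sum>j<l. c i j * \<eta> j else 0)" using assms unfolding W_def by blast
  obtain t where t: "\<And>u k. deg_le_outside F \<alpha> u \<Longrightarrow> squarefree_vec u \<Longrightarrow>
      Poly_Mapping.lookup (localize_shift F t + \<alpha> - to_int_vec u) k \<ge> 0"
    using ex_shift[of F \<alpha>] by blast
  define b where "b = localize_shift F t + \<alpha>"
  \<comment> \<open>The multipliers of the columns after clearing denominators. For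
    \<open>j < l\<close> the exponent \<open>b - \<gamma> j\<close> is nonnegative whenever
    \<open>\<eta> j\<close> is nonzero, so \<open>pos_part\<close> only changes its type; where
    \<open>\<eta> j = 0\<close> the monomial is 0.\<close>
  define w where "w j = Poly_Mapping.single (pos_part (b - to_int_vec (\<gamma> j))) (\<eta> j)" for j
  define m where "m i = (if i < s then \<Sum>j<l. Poly_Mapping.single (a i j) (c i j) * w j else 0)" for i
  have "m \<in> N" unfolding N_iff m_def by blast
  moreover have "Poly_Mapping.single (localize_shift F t) 1 * Poly_Mapping.single (\<alpha> - to_int_vec (\<beta> i)) (\<xi> i) = to_laurent (m i)" for i
  proof (cases "i < s")
    case True
    have "Poly_Mapping.single (to_int_vec (a i j)) (c i j) * Poly_Mapping.single (to_int_vec (pos_part (b - to_int_vec (\<gamma> j)))) (\<eta> j)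
        = Poly_Mapping.single (b - to_int_vec (\<beta> i)) (c i j * \<eta> j)" if "j < l" for j
    proof (cases "c i j = 0 \<or> \<eta> j = 0")
      case False
      have "to_int_vec (pos_part (b - to_int_vec (\<gamma> j))) = b - to_int_vec (\<gamma> j)"
        unfolding b_def using \<eta>[OF that] False sqfree(1)[OF that] by (intro to_int_vec_pos_part t) auto
      thus ?thesis using degree_eq[OF True that] False by (simp add: mult_single)
    qed auto
    hence "to_laurent (m i) = (\<Sum>j<l. Poly_Mapping.single (b - to_int_vec (\<beta> i)) (c i j * \<eta> j))"
      using True by (simp add: m_def to_laurent_sum to_laurent_single_mult w_def to_laurent_single)
    also have "\<dots> = Poly_Mapping.single (b - to_int_vec (\<beta> i)) (\<xi> i)" using True by (simp add: single_sum \<xi>)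
    finally show ?thesis by (simp add: mult_single b_def algebra_simps)
  qed (simp add: \<xi> m_def)
  ultimately show ?thesis unfolding localized_iff by blast
qed

lemma localized_free_component:
  assumes "w \<in> localized F (free_module s)"
    and "Poly_Mapping.lookup (w i) (\<alpha> - to_int_vec (\<beta> i)) \<noteq> 0"
  shows "i < s \<and> deg_le_outside F \<alpha> (\<beta> i)"
proof -
  from assms obtain t m where "m \<in> free_module s"
    and w: "\<And>i. Poly_Mapping.single (localize_shift F t) 1 * w i = to_laurent (m i)"
    unfolding localized_iff by blast
  define b where "b = localize_shift F t + \<alpha>"
  have nz: "Poly_Mapping.lookup (to_laurent (m i)) (b - to_int_vec (\<beta> i)) \<noteq> 0"
    using lookup_single_mult_add[of "localize_shift F t" 1 "w i" "\<alpha> - to_int_vec (\<beta> i)"] w[of i] assms(2)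
    by (simp add: b_def algebra_simps)
  hence "m i \<noteq> 0" by auto
  hence "i < s" using \<open>m \<in> free_module s\<close> by (auto simp: free_module_def not_less[symmetric])
  moreover have "deg_le_outside F \<alpha> (\<beta> i)"
    unfolding deg_le_outside_def
  proof (intro allI impI)
    fix k assume k: "k \<notin> F"
    from nz obtain u where "b - to_int_vec (\<beta> i) = to_int_vec u"
      by (rule lookup_to_laurent_range)
    from arg_cong[OF this, of "\<lambda>x. Poly_Mapping.lookup x k"] k
    show "int (Poly_Mapping.lookup (\<beta> i) k) \<le> Poly_Mapping.lookup \<alpha> k"
      by (simp add: b_def lookup_minus lookup_add lookup_localize_shift)
  qed
  ultimately show ?thesis by blast
qed

lemma localized_free_monomials:
  assumes "\<And>i. \<xi> i \<noteq> 0 \<Longrightarrow> i < s \<and> deg_le_outside F \<alpha> (\<beta> i)"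
  shows "(\<lambda>i. Poly_Mapping.single (\<alpha> - to_int_vec (\<beta> i)) (\<xi> i)) \<in> localized F (free_module s)"
proof -
  obtain t where t: "\<And>u k. deg_le_outside F \<alpha> u \<Longrightarrow> squarefree_vec u \<Longrightarrow>
      Poly_Mapping.lookup (localize_shift F t + \<alpha> - to_int_vec u) k \<ge> 0"
    using ex_shift[of F \<alpha>] by blast
  define b where "b = localize_shift F t + \<alpha>"
  define m where "m i = Poly_Mapping.single (pos_part (b - to_int_vec (\<beta> i))) (\<xi> i)" for i
  have "\<xi> i = 0" if "i \<ge> s" for i using assms[of i] that by auto
  hence "m \<in> free_module s" by (simp add: free_module_def m_def)
  moreover have "Poly_Mapping.single (localize_shift F t) 1 * Poly_Mapping.single (\<alpha> - to_int_vec (\<beta> i)) (\<xi> i) = to_laurent (m i)" for i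
  proof (cases "\<xi> i = 0")
    case False
    hence "to_int_vec (pos_part (b - to_int_vec (\<beta> i))) = b - to_int_vec (\<beta> i)"
      unfolding b_def using assms sqfree(2) by (intro to_int_vec_pos_part t) auto
    thus ?thesis by (simp add: mult_single m_def to_laurent_single) (simp add: b_def add_diff_eq)
  qed (simp add: m_def)
  ultimately show ?thesis unfolding localized_iff by blast
qed

text \<open>Localizing at the empty set inverts nothing, so the unlocalized module is covered by the
  results above.\<close>

lemma N_iff_localized: "m \<in> N \<longleftrightarrow> (\<lambda>i. to_laurent (m i)) \<in> localized {} N"
  unfolding localized_iff by (auto simp: localize_shift_def to_laurent_eq_iff simp flip: fun_eq_iff)

lemma N_component:
  assumes "m \<in> N"
  shows "(\<lambda>i. Poly_Mapping.lookup (to_laurent (m i)) (to_int_vec b - to_int_vec (\<beta> i))) \<in> W {} (to_int_vec b)"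
  using assms unfolding N_iff_localized by (rule localized_N_component)

lemma N_monomials_iff:
  assumes "\<And>i. \<xi> i \<noteq> 0 \<Longrightarrow> deg_le_outside {} (to_int_vec b) (\<beta> i)"
  shows "(\<lambda>i. Poly_Mapping.single (b - \<beta> i) (\<xi> i)) \<in> N \<longleftrightarrow> \<xi> \<in> W {} (to_int_vec b)"
proof -
  \<comment> \<open>The subtraction \<open>b - \<beta> i\<close> is truncated, but it is genuine
    where \<open>\<xi> i\<close> is nonzero, and the monomial is 0 elsewhere.\<close>
  have eq: "to_laurent (Poly_Mapping.single (b - \<beta> i) (\<xi> i)) = Poly_Mapping.single (to_int_vec b - to_int_vec (\<beta> i)) (\<xi> i)" for i
  proof (cases "\<xi> i = 0")
    case False
    hence "to_int_vec (b - \<beta> i) = to_int_vec b - to_int_vec (\<beta> i)"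
      using assms by (intro to_int_vec_diff) (auto simp: deg_le_outside_empty)
    thus ?thesis by (simp add: to_laurent_single)
  qed simp
  show ?thesis
  proof
    assume "(\<lambda>i. Poly_Mapping.single (b - \<beta> i) (\<xi> i)) \<in> N"
    from N_component[OF this, of b] show "\<xi> \<in> W {} (to_int_vec b)" by (simp add: eq)
  next
    assume "\<xi> \<in> W {} (to_int_vec b)"
    from localized_N_monomials[OF this] show "(\<lambda>i. Poly_Mapping.single (b - \<beta> i) (\<xi> i)) \<in> N"
      by (simp add: N_iff_localized eq)
  qed
qed

end

section \<open>Leading terms and reduction coefficients\<close>

lemma lead_idx_mono: "W \<subseteq> W' \<Longrightarrow> lead_idx W \<subseteq> lead_idx W'"
  unfolding lead_idx_def by blast

lemma var_prod_eq_single: "var_prod F = Poly_Mapping.single (indicator_vec F) (1::'k::comm_ring_1)"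
  using var_prod_power[of F 1, where 'e = nat] by (simp add: indicator_vec_def)

lemma module_pointwise_mult: "Modules.module (\<lambda>(p::'r::comm_ring_1) f (i::'i). p * f i)"
  by standard (simp_all add: fun_eq_iff algebra_simps)

lemma vector_space_L_scale: "vector_space (L_scale :: 'k::field \<Rightarrow> ('b \<Rightarrow>\<^sub>0 'k) \<Rightarrow> _)"
proof -
  have l: "Poly_Mapping.lookup (L_scale a f) b = a * Poly_Mapping.lookup f b" for a :: 'k and f :: "'b \<Rightarrow>\<^sub>0 'k" and b
    by (simp add: L_scale_def Poly_Mapping.map.rep_eq when_def)
  show ?thesis
    by standard (simp_all add: poly_mapping_eq_iff fun_eq_iff l lookup_add algebra_simps)
qed

lemma lookup_cech_scale: "Poly_Mapping.lookup (cech_scale a z F i) d = a * Poly_Mapping.lookup (z F i) d"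
  by (simp add: cech_scale_def Poly_Mapping.map.rep_eq when_def)

lemma vector_space_cech_scale:
  "vector_space (cech_scale :: 'k::field \<Rightarrow> ('n set \<Rightarrow> nat \<Rightarrow> ('n, 'k) laurent_ring) \<Rightarrow> _)"
  by standard (simp_all add: poly_mapping_eq_iff fun_eq_iff lookup_cech_scale lookup_add algebra_simps)

lemma linear_L_diff:
  fixes N :: "(nat \<Rightarrow> ('n::linorder, 'k::field) poly_ring) set"
  shows "Vector_Spaces.linear L_scale L_scale (L_diff leq N \<beta> \<alpha>)"
proof -
  define D where "D = L_diff_basis leq N \<beta> \<alpha>"
  interpret V: vector_space "L_scale :: 'k \<Rightarrow> (nat \<times> 'n set \<Rightarrow>\<^sub>0 'k) \<Rightarrow> _" by (rule vector_space_L_scale)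
  \<comment> \<open>Summing over an arbitrary finite superset of the support lets \<open>f\<close>,
    \<open>g\<close> and \<open>f + g\<close> share one index set.\<close>
  have ext: "L_diff leq N \<beta> \<alpha> f = (\<Sum>b\<in>A. L_scale (Poly_Mapping.lookup f b) (D b))"
    if "finite A" "Poly_Mapping.keys f \<subseteq> A" for f A
    unfolding L_diff_def D_def by (rule sum.mono_neutral_left) (use that in \<open>auto simp: in_keys_iff\<close>)
  have l: "Poly_Mapping.lookup (L_scale a f) b = a * Poly_Mapping.lookup f b"
    for a :: 'k and f :: "nat \<times> 'n set \<Rightarrow>\<^sub>0 'k" and b
    by (simp add: L_scale_def Poly_Mapping.map.rep_eq when_def)
  show ?thesis
  proof (rule Vector_Spaces.linear_iff[THEN iffD2], intro conjI allI)
    fix f g :: "nat \<times> 'n set \<Rightarrow>\<^sub>0 'k"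
    define A where "A = Poly_Mapping.keys f \<union> Poly_Mapping.keys g"
    have A: "finite A" "Poly_Mapping.keys f \<subseteq> A" "Poly_Mapping.keys g \<subseteq> A" "Poly_Mapping.keys (f + g) \<subseteq> A"
      using Poly_Mapping.keys_add[of f g] by (auto simp: A_def)
    show "L_diff leq N \<beta> \<alpha> (f + g) = L_diff leq N \<beta> \<alpha> f + L_diff leq N \<beta> \<alpha> g"
      by (simp add: ext[OF A(1,2)] ext[OF A(1,3)] ext[OF A(1,4)] lookup_add V.scale_left_distrib sum.distrib)
  next
    fix a and f :: "nat \<times> 'n set \<Rightarrow>\<^sub>0 'k"
    have "Poly_Mapping.keys (L_scale a f) \<subseteq> Poly_Mapping.keys f" by (auto simp: in_keys_iff l)
    thus "L_diff leq N \<beta> \<alpha> (L_scale a f) = L_scale a (L_diff leq N \<beta> \<alpha> f)"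
      by (simp add: ext[of "Poly_Mapping.keys f"] l V.scale_sum_right)
  qed (rule vector_space_L_scale)+
qed

context squarefree_presentation
begin

text \<open>From left to right, the component of \<open>f\<close> in degree
  \<open>u + \<beta> i\<close> is a relation with leading index \<open>i\<close>. Conversely, such a
  relation spreads to a homogeneous element of \<open>N\<close> whose only monomial on generator
  \<open>i\<close> is that of exponent \<open>u\<close>, all others lying on smaller
  generators.\<close>

lemma exists_leading_iff:
  "(\<exists>f\<in>N. is_leading_monomial leq f (i, u)) \<longleftrightarrow> i \<in> lead_idx (W {} (to_int_vec (u + \<beta> i)))"
proof
  define b where "b = u + \<beta> i"
  assume "\<exists>f\<in>N. is_leading_monomial leq f (i, u)"
  then obtain f where f: "f \<in> N" "is_leading_monomial leq f (i, u)" by blast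
  define \<xi> where "\<xi> j = Poly_Mapping.lookup (to_laurent (f j)) (to_int_vec b - to_int_vec (\<beta> j))" for j
  have "to_int_vec b - to_int_vec (\<beta> i) = to_int_vec u" by (simp add: b_def to_int_vec_add)
  hence "\<xi> i \<noteq> 0" using f(2)
    by (auto simp: \<xi>_def lookup_to_laurent is_leading_monomial_def monomials_of_def in_keys_iff)
  moreover have "\<xi> j = 0" if "j > i" for j
  proof -
    have "Poly_Mapping.keys (f j) = {}"
    proof (rule ccontr)
      assume "Poly_Mapping.keys (f j) \<noteq> {}"
      then obtain v where "(j, v) \<in> monomials_of f" unfolding monomials_of_def by blast
      with f(2) that show False by (auto simp: is_leading_monomial_def)
    qed
    thus ?thesis by (simp add: \<xi>_def)
  qed
  moreover have "\<xi> \<in> W {} (to_int_vec b)" unfolding \<xi>_def[abs_def] by (rule N_component[OF f(1)])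
  ultimately show "i \<in> lead_idx (W {} (to_int_vec (u + \<beta> i)))" by (auto simp: lead_idx_def b_def)
next
  define b where "b = u + \<beta> i"
  assume "i \<in> lead_idx (W {} (to_int_vec (u + \<beta> i)))"
  then obtain \<xi> where \<xi>: "\<xi> \<in> W {} (to_int_vec b)" "\<xi> i \<noteq> 0" "\<And>j. j > i \<Longrightarrow> \<xi> j = 0"
    unfolding lead_idx_def b_def by blast
  define f where "f j = Poly_Mapping.single (b - \<beta> j) (\<xi> j)" for j
  have "f \<in> N" unfolding f_def[abs_def] by (subst N_monomials_iff) (use \<xi>(1) W_supp in auto)
  moreover have "leq u u"
    using mon by (simp add: monomial_order_def class.linorder_def class.order_def class.preorder_def)
  hence "module_le leq (j, b - \<beta> j) (i, u)" if "\<xi> j \<noteq> 0" for j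
    using that \<xi>(3)[of j] by (cases j i rule: linorder_cases) (auto simp: b_def)
  hence "is_leading_monomial leq f (i, u)"
    using \<xi>(2) unfolding is_leading_monomial_def monomials_of_def f_def
    by (auto simp: b_def split: if_splits)
  ultimately show "\<exists>f\<in>N. is_leading_monomial leq f (i, u)" by blast
qed

text \<open>The vectors all of whose monomials satisfy the criterion form a submodule
  \<open>S\<close>, since multiplication by a monomial raises the degree and enlarges
  \<open>W\<close>. \<open>S\<close> contains the generators of the initial module, hence the whole
  of it.\<close>

lemma initial_module_iff:
  "mono_elem u i \<in> initial_module leq N \<longleftrightarrow> i \<in> lead_idx (W {} (to_int_vec (u + \<beta> i)))"
proof
  interpret Modules.module "\<lambda>(p::('n, 'k) poly_ring) f (i::nat). p * f i" by (rule module_pointwise_mult)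
  show "i \<in> lead_idx (W {} (to_int_vec (u + \<beta> i))) \<Longrightarrow> mono_elem u i \<in> initial_module leq N"
    unfolding initial_module_def by (intro span_base CollectI exI[of _ u] exI[of _ i] conjI) (auto simp: exists_leading_iff)
  define S :: "(nat \<Rightarrow> ('n, 'k) poly_ring) set" where "S = {g. \<forall>i. \<forall>u\<in>Poly_Mapping.keys (g i). i \<in> lead_idx (W {} (to_int_vec (u + \<beta> i)))}"
  assume "mono_elem u i \<in> initial_module leq N"
  moreover have "initial_module leq N \<subseteq> S"
    unfolding initial_module_def
  proof (rule span_minimal)
    show "subspace S"
    proof (rule subspaceI)
      show "0 \<in> S" by (simp add: S_def)
      fix f g assume "f \<in> S" "g \<in> S"
      thus "f + g \<in> S" using Poly_Mapping.keys_add[of "f _" "g _"] unfolding S_def by fastforce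
    next
      fix p :: "('n, 'k) poly_ring" and g assume g: "g \<in> S"
      show "(\<lambda>i. p * g i) \<in> S"
        unfolding S_def
      proof (intro CollectI allI ballI)
        fix i u assume "u \<in> Poly_Mapping.keys (p * g i)"
        with keys_mult[of p "g i"] obtain v w where u: "u = v + w" "w \<in> Poly_Mapping.keys (g i)" by blast
        have "W {} (to_int_vec (w + \<beta> i)) \<subseteq> W {} (to_int_vec (u + \<beta> i))"
          by (rule W_mono, erule deg_le_outside_mono) (simp_all add: u lookup_add)
        hence "lead_idx (W {} (to_int_vec (w + \<beta> i))) \<subseteq> lead_idx (W {} (to_int_vec (u + \<beta> i)))"
          by (rule lead_idx_mono)
        moreover have "i \<in> lead_idx (W {} (to_int_vec (w + \<beta> i)))"
          using g[unfolded S_def mem_Collect_eq] u(2) by simp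
        ultimately show "i \<in> lead_idx (W {} (to_int_vec (u + \<beta> i)))" by (rule subsetD)
      qed
    qed
  next
    show "{mono_elem u i |u i. \<exists>f\<in>N. is_leading_monomial leq f (i, u)} \<subseteq> S"
      unfolding exists_leading_iff by (auto simp: S_def gen_mult_def split: if_splits)
  qed
  ultimately have "(mono_elem u i :: nat \<Rightarrow> ('n, 'k) poly_ring) \<in> S" by blast
  thus "i \<in> lead_idx (W {} (to_int_vec (u + \<beta> i)))" by (auto simp: S_def gen_mult_def)
qed

lemma initial_complex_iff:
  "S \<in> initial_complex leq N i \<longleftrightarrow> i \<notin> lead_idx (W {} (to_int_vec (indicator_vec S + \<beta> i)))"
  by (simp add: initial_complex_def initial_ideal_def var_prod_eq_single initial_module_iff)

end

section \<open>A fixed degree: comparison with the combinatorial complex\<close>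

locale squarefree_presentation_degree = squarefree_presentation s l c a \<gamma> \<beta> leq
  for s l :: nat
    and c :: "nat \<Rightarrow> nat \<Rightarrow> 'k::field"
    and a :: "nat \<Rightarrow> nat \<Rightarrow> ('n::{finite,linorder} \<Rightarrow>\<^sub>0 nat)"
    and \<gamma> \<beta> :: "nat \<Rightarrow> ('n \<Rightarrow>\<^sub>0 nat)"
    and leq :: "('n \<Rightarrow>\<^sub>0 nat) \<Rightarrow> ('n \<Rightarrow>\<^sub>0 nat) \<Rightarrow> bool" +
  fixes \<alpha> :: "'n \<Rightarrow>\<^sub>0 int"
begin

lemma neg_support_iff:
  "k \<in> neg_support \<beta> \<alpha> i \<longleftrightarrow> Poly_Mapping.lookup \<alpha> k < int (Poly_Mapping.lookup (\<beta> i) k)"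
  by (auto simp: neg_support_def in_keys_iff lookup_neg_part shifted_def lookup_minus)

lemma deg_le_outside_neg_support: "deg_le_outside F \<alpha> (\<beta> i) \<longleftrightarrow> neg_support \<beta> \<alpha> i \<subseteq> F"
  by (auto simp: deg_le_outside_def neg_support_iff subset_iff not_less)

sublocale cech_filtration s "neg_support \<beta> \<alpha>" "\<lambda>F. W F \<alpha>"
proof
  show "\<xi> \<in> W F \<alpha> \<Longrightarrow> \<xi> i \<noteq> 0 \<Longrightarrow> i < s \<and> neg_support \<beta> \<alpha> i \<subseteq> F" for \<xi> F i
    using W_supp[of \<xi> F \<alpha> i] deg_le_outside_neg_support by blast
  show "F \<subseteq> G \<Longrightarrow> W F \<alpha> \<subseteq> W G \<alpha>" for F G
    by (rule W_mono, erule deg_le_outside_mono) auto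
qed (fact W_zero W_add W_scale)+

lemma alpha_nonneg: "neg_support \<beta> \<alpha> i \<subseteq> F \<Longrightarrow> k \<notin> F \<Longrightarrow> Poly_Mapping.lookup \<alpha> k \<ge> int (Poly_Mapping.lookup (\<beta> i) k)"
  using neg_support_iff[of k i] by fastforce

lemma W_eq_W:
  assumes "neg_support \<beta> \<alpha> i \<subseteq> F" "Poly_Mapping.keys b = F \<union> {k. Poly_Mapping.lookup \<alpha> k > 0}"
  shows "W {} (to_int_vec b) = W F \<alpha>"
  by (rule W_eq_support[OF _ assms(2)]) (use alpha_nonneg[OF assms(1)] in force)

text \<open>The tested squarefree monomial times generator \<open>i\<close> has degree
  \<open>b\<close>, whose support is \<open>F\<close> together with the positive support of
  \<alpha>. By \<open>W_eq_W\<close> its leading indices are those over \<open>F\<close>.\<close>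

lemma degree_complex_iff:
  assumes "i < s"
  shows "\<tau> \<in> degree_complex leq N \<beta> \<alpha> i \<longleftrightarrow>
    \<tau> \<inter> neg_support \<beta> \<alpha> i = {} \<and> i \<in> std (\<tau> \<union> neg_support \<beta> \<alpha> i)"
proof -
  define F where "F = \<tau> \<union> neg_support \<beta> \<alpha> i"
  define b where "b = indicator_vec (\<tau> \<union> Poly_Mapping.keys (shifted \<beta> \<alpha> i)) + \<beta> i"
  have "k \<in> Poly_Mapping.keys b \<longleftrightarrow> k \<in> F \<union> {k. Poly_Mapping.lookup \<alpha> k > 0}" for k
    using neg_support_iff[of k i]
    by (auto simp: in_keys_iff b_def F_def lookup_add lookup_indicator_vec shifted_def lookup_minus)
  hence "W {} (to_int_vec b) = W F \<alpha>" by (intro W_eq_W[of i]) (auto simp: F_def)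
  thus ?thesis using assms by (auto simp: degree_complex_def initial_complex_iff std_def F_def b_def)
qed

text \<open>Since \<open>\<tau>\<close> is disjoint from the negative support of generator
  \<open>i\<close>, the sizes add, and \<open>degree_shift\<close> cancels the size for
  \<open>i\<close> against that for index 0. The final 1 is the offset between size and dimension of
  a face.\<close>

lemma L_space_eq: "L_space s leq N \<beta> \<alpha> r = L_sp (r + int (card (neg_support \<beta> \<alpha> 0)) + 1)"
proof -
  have "card (\<tau> \<union> neg_support \<beta> \<alpha> i) = card \<tau> + card (neg_support \<beta> \<alpha> i)"
    if "\<tau> \<inter> neg_support \<beta> \<alpha> i = {}" for \<tau> i
    using that by (intro card_Un_disjoint) auto
  hence "{(i, \<tau>). i < s \<and> \<tau> \<in> degree_complex leq N \<beta> \<alpha> i \<and> int (card \<tau>) = (r - degree_shift \<beta> \<alpha> i) + 1}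
    = L_idx (r + int (card (neg_support \<beta> \<alpha> 0)) + 1)"
    by (auto simp: L_idx_def degree_complex_iff degree_shift_def std_def)
  thus ?thesis by (simp add: L_space_def L_sp_def)
qed

text \<open>In degree \<open>u + \<beta> i\<close> the relations coincide with those over
  \<open>G\<close>, so the two definite descriptions pick out the same coefficient vector.\<close>

lemma reduction_coeffs_eq_red:
  assumes i: "i < s" "neg_support \<beta> \<alpha> i \<subseteq> G" "i \<notin> std G"
  shows "reduction_coeffs leq N \<beta> i (pos_part (shifted \<beta> \<alpha> i) + indicator_vec G) = red G i"
proof -
  define u where "u = pos_part (shifted \<beta> \<alpha> i) + indicator_vec G"
  define b where "b = u + \<beta> i"
  \<comment> \<open>Outside \<open>G\<close> the degree \<open>b\<close> is exactly \<alpha>; on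
    \<open>G\<close> the indicator vector makes it positive. This determines its support.\<close>
  have out: "int (Poly_Mapping.lookup b k) = Poly_Mapping.lookup \<alpha> k" if "k \<notin> G" for k
    using alpha_nonneg[OF i(2) that] that
    by (simp add: b_def u_def lookup_add lookup_pos_part lookup_indicator_vec shifted_def lookup_minus)
  have "k \<in> Poly_Mapping.keys b \<longleftrightarrow> k \<in> G \<union> {k. Poly_Mapping.lookup \<alpha> k > 0}" for k
  proof (cases "k \<in> G")
    case True
    thus ?thesis by (simp add: b_def u_def in_keys_iff lookup_add lookup_indicator_vec)
  next
    case False
    thus ?thesis using out[of k] by (auto simp: in_keys_iff)
  qed
  hence keys: "Poly_Mapping.keys b = G \<union> {k. Poly_Mapping.lookup \<alpha> k > 0}" by blast
  have Wb: "W {} (to_int_vec b) = W G \<alpha>" by (rule W_eq_W[OF i(2) keys])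
  have Gpos: "\<And>k. k \<notin> G \<Longrightarrow> Poly_Mapping.lookup \<alpha> k \<ge> 0" using out by (metis of_nat_0_le_iff)
  have bpos: "{k. Poly_Mapping.lookup (to_int_vec b) k > 0} = Poly_Mapping.keys b" by (auto simp: in_keys_iff)
  have le: "(\<forall>k. Poly_Mapping.lookup (\<beta> j) k \<le> Poly_Mapping.lookup b k) \<longleftrightarrow> neg_support \<beta> \<alpha> j \<subseteq> G" if "j < s" for j
    unfolding deg_le_outside_empty[symmetric] deg_le_outside_neg_support[symmetric]
    using that Gpos bpos keys by (simp add: deg_le_outside_squarefree sqfree)
  \<comment> \<open>The initial complex sees only the support of \<open>b - \<beta> j\<close>;
    adding \<open>\<beta> j\<close> back gives the support of \<open>b\<close> again, whence the
    relations over \<open>G\<close>.\<close>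
  have std: "(\<forall>k. Poly_Mapping.lookup (\<beta> j) k \<le> Poly_Mapping.lookup b k) \<and>
      Poly_Mapping.keys (b - \<beta> j) \<in> initial_complex leq N j \<longleftrightarrow> j \<in> std G" if j: "j < s" for j
  proof (cases "neg_support \<beta> \<alpha> j \<subseteq> G")
    case True
    hence "\<forall>k. Poly_Mapping.lookup (\<beta> j) k \<le> Poly_Mapping.lookup b k" using le[OF j] by blast
    hence "k \<in> Poly_Mapping.keys (indicator_vec (Poly_Mapping.keys (b - \<beta> j)) + \<beta> j) \<longleftrightarrow> k \<in> Poly_Mapping.keys b" for k
      by (auto simp: in_keys_iff lookup_add lookup_indicator_vec lookup_minus dest: spec[of _ k])
    hence "Poly_Mapping.keys (indicator_vec (Poly_Mapping.keys (b - \<beta> j)) + \<beta> j) = Poly_Mapping.keys b" by blast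
    hence "W {} (to_int_vec (indicator_vec (Poly_Mapping.keys (b - \<beta> j)) + \<beta> j)) = W G \<alpha>"
      by (intro W_eq_W[OF True]) (simp add: keys)
    thus ?thesis using True j le[OF j] by (simp add: initial_complex_iff std_def)
  next
    case False
    thus ?thesis using le[OF j] by (auto simp: std_def)
  qed
  have "(\<forall>j. \<rho> j \<noteq> 0 \<longrightarrow> j < i \<and> (\<forall>k. Poly_Mapping.lookup (\<beta> j) k \<le> Poly_Mapping.lookup (u + \<beta> i) k) \<and>
           Poly_Mapping.keys (u + \<beta> i - \<beta> j) \<in> initial_complex leq N j) \<and>
        mono_elem u i - (\<Sum>j<i. gen_mult (Poly_Mapping.single (u + \<beta> i - \<beta> j) (\<rho> j)) j) \<in> N
      \<longleftrightarrow> is_nf G (unit_fun i) \<rho>" (is "?P \<and> ?Q \<longleftrightarrow> _") for \<rho>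
  proof -
    have P: "?P \<longleftrightarrow> (\<forall>j. \<rho> j \<noteq> 0 \<longrightarrow> j < i \<and> j \<in> std G)"
      unfolding b_def[symmetric] using std i(1) by (meson order_less_trans)
    have Q: "?Q \<longleftrightarrow> (\<lambda>j. unit_fun i j - \<rho> j) \<in> W G \<alpha>" if ?P
    proof -
      have "mono_elem u i - (\<Sum>j<i. gen_mult (Poly_Mapping.single (u + \<beta> i - \<beta> j) (\<rho> j)) j)
          = (\<lambda>j. Poly_Mapping.single (b - \<beta> j) (unit_fun i j - \<rho> j))"
      proof
        fix k
        have s: "(\<Sum>j<i. gen_mult (Poly_Mapping.single (b - \<beta> j) (\<rho> j)) j) k = (\<Sum>j<i. gen_mult (Poly_Mapping.single (b - \<beta> j) (\<rho> j)) j k)"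
          by (induction i) simp_all
        have "\<rho> k = 0" if "\<not> k < i" using \<open>?P\<close> that by blast
        thus "(mono_elem u i - (\<Sum>j<i. gen_mult (Poly_Mapping.single (u + \<beta> i - \<beta> j) (\<rho> j)) j)) k
          = Poly_Mapping.single (b - \<beta> k) (unit_fun i k - \<rho> k)"
          unfolding b_def[symmetric] minus_apply s
          by (auto simp: gen_mult_def unit_fun_def single_diff b_def)
      qed
      moreover have "deg_le_outside {} (to_int_vec b) (\<beta> j)" if "unit_fun i j - \<rho> j \<noteq> 0" for j
      proof (cases "j = i")
        case True
        thus ?thesis by (simp add: deg_le_outside_empty b_def lookup_add)
      next
        case False
        thus ?thesis using that \<open>?P\<close> unfolding deg_le_outside_empty b_def by (auto simp: unit_fun_def)
      qed
      ultimately show ?thesis using N_monomials_iff[of "\<lambda>j. unit_fun i j - \<rho> j" b] by (simp add: Wb)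
    qed
    \<comment> \<open>The bound \<open>j < i\<close> in the definition of the coefficients holds for
      every normal form here, since generator \<open>i\<close> is not standard over
      \<open>G\<close>.\<close>
    have "j < i" if "is_nf G (unit_fun i) \<rho>" "\<rho> j \<noteq> 0" for j
      using red_eqI[OF i(1,2) that(1)] red_less[OF i(3)] that(2) by metis
    thus ?thesis using P Q by (auto simp: is_nf_def)
  qed
  thus ?thesis using i unfolding reduction_coeffs_def red_def u_def by simp
qed

text \<open>A vertex \<open>h\<close> extends \<open>\<tau>\<close> to a face exactly if generator
  \<open>i\<close> stays standard over \<open>G h\<close>, so the two branches of
  \<open>dL_single\<close> become the two sums of the combinatorial differential.\<close>

lemma dL_single_eq_L_diff_basis:
  assumes b: "(i, \<tau>) \<in> L_idx p"
  shows "dL (Poly_Mapping.single (i, \<tau>) 1) = L_diff_basis leq N \<beta> \<alpha> (i, \<tau>)"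
proof -
  let ?\<sigma> = "neg_support \<beta> \<alpha>" and ?\<Delta> = "degree_complex leq N \<beta> \<alpha> i"
  have i: "i < s" and disj: "\<tau> \<inter> ?\<sigma> i = {}" using b by (auto simp: L_idx_def std_def)
  define G where "G h = insert h \<tau> \<union> ?\<sigma> i" for h
  have ext: "insert h \<tau> \<in> ?\<Delta> \<longleftrightarrow> i \<in> std (G h)" if "h \<in> - ?\<sigma> i - \<tau>" for h
    unfolding degree_complex_iff[OF i] G_def using that disj by auto
  define f where "f h = Poly_Mapping.single (i, insert h \<tau>) (sgn_in h (insert h \<tau>) :: 'k)" for h
  define g where "g h = (\<Sum>j<i. Poly_Mapping.single (j, G h - ?\<sigma> j)
          (sgn_in h (insert h \<tau>) * red (G h) i j * (t_sgn (?\<sigma> i) (G h) / t_sgn (?\<sigma> j) (G h))))" for h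
  have "dL (Poly_Mapping.single (i, \<tau>) 1) = (\<Sum>h\<in>- ?\<sigma> i - \<tau>. if i \<in> std (G h) then f h else g h)"
    unfolding dL_single[OF b] Let_def f_def g_def G_def ..
  also have "\<dots> = (\<Sum>h\<in>- ?\<sigma> i - \<tau>. if insert h \<tau> \<in> ?\<Delta> then f h else g h)"
    by (intro sum.cong refl) (simp add: ext)
  also have "\<dots> = (\<Sum>h\<in>ext_vertices (- ?\<sigma> i) ?\<Delta> \<tau>. f h) + (\<Sum>h\<in>non_ext_vertices (- ?\<sigma> i) ?\<Delta> \<tau>. g h)"
    by (subst sum.If_cases) (auto simp: ext_vertices_def non_ext_vertices_def Int_def Compl_eq intro!: arg_cong2[where f = plus] sum.cong)
  also have "(\<Sum>h\<in>non_ext_vertices (- ?\<sigma> i) ?\<Delta> \<tau>. g h) = (\<Sum>h\<in>non_ext_vertices (- ?\<sigma> i) ?\<Delta> \<tau>. \<Sum>j<i.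
      Poly_Mapping.single (j, G h - ?\<sigma> j) (sgn_in h (insert h \<tau>) *
        reduction_coeffs leq N \<beta> i (pos_part (shifted \<beta> \<alpha> i) + indicator_vec (G h)) j *
        (t_sgn (?\<sigma> i) (G h) / t_sgn (?\<sigma> j) (G h))))"
  proof (rule sum.cong[OF refl])
    fix h assume h: "h \<in> non_ext_vertices (- ?\<sigma> i) ?\<Delta> \<tau>"
    hence "i \<notin> std (G h)" using ext[of h] by (auto simp: non_ext_vertices_def)
    hence "reduction_coeffs leq N \<beta> i (pos_part (shifted \<beta> \<alpha> i) + indicator_vec (G h)) = red (G h) i"
      by (intro reduction_coeffs_eq_red i) (auto simp: G_def)
    thus "g h = (\<Sum>j<i. Poly_Mapping.single (j, G h - ?\<sigma> j) (sgn_in h (insert h \<tau>) *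
        reduction_coeffs leq N \<beta> i (pos_part (shifted \<beta> \<alpha> i) + indicator_vec (G h)) j *
        (t_sgn (?\<sigma> i) (G h) / t_sgn (?\<sigma> j) (G h))))" by (simp add: g_def)
  qed
  finally show ?thesis by (simp add: L_diff_basis_def Let_def f_def G_def)
qed

lemma linear_dL: "Vector_Spaces.linear L_scale L_scale dL"
  by (rule Vector_Spaces.linear_iff[THEN iffD2]) (simp add: vector_space_L_scale dL_add dL_scale)

text \<open>Both maps are determined linearly by basis elements, and those in the support of
  \<open>f\<close> lie in \<open>L_idx p\<close>, where the two agree.\<close>

lemma L_diff_eq_dL:
  assumes "f \<in> L_sp p"
  shows "L_diff leq N \<beta> \<alpha> f = dL f"
proof -
  interpret Vector_Spaces.linear L_scale L_scale dL by (rule linear_dL)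
  have "f = (\<Sum>b\<in>Poly_Mapping.keys f. L_scale (Poly_Mapping.lookup f b) (Poly_Mapping.single b 1))"
    by (rule poly_mapping_eqI) (simp add: lookup_sum lookup_single when_def in_keys_iff if_distrib cong: if_cong)
  hence "dL f = (\<Sum>b\<in>Poly_Mapping.keys f. L_scale (Poly_Mapping.lookup f b) (dL (Poly_Mapping.single b 1)))"
    by (metis (no_types, lifting) sum scale sum.cong)
  also have "\<dots> = L_diff leq N \<beta> \<alpha> f"
    unfolding L_diff_def
  proof (rule sum.cong[OF refl])
    fix b assume "b \<in> Poly_Mapping.keys f"
    hence "b \<in> L_idx p" using assms by (auto simp: L_sp_def)
    thus "L_scale (Poly_Mapping.lookup f b) (dL (Poly_Mapping.single b 1)) =
        L_scale (Poly_Mapping.lookup f b) (L_diff_basis leq N \<beta> \<alpha> b)"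
      using dL_single_eq_L_diff_basis[of "fst b" "snd b" p] by simp
  qed
  finally show ?thesis by simp
qed

section \<open>Cech cochains of the fixed degree and their coefficients\<close>

definition coef :: "('n set \<Rightarrow> nat \<Rightarrow> ('n, 'k) laurent_ring) \<Rightarrow> 'n set \<Rightarrow> nat \<Rightarrow> 'k" where
  "coef z F i = Poly_Mapping.lookup (z F i) (\<alpha> - to_int_vec (\<beta> i))"

text \<open>A right inverse of \<open>coef\<close>, and a two-sided one on homogeneous
  families.\<close>

definition mono_family :: "('n set \<Rightarrow> nat \<Rightarrow> 'k) \<Rightarrow> 'n set \<Rightarrow> nat \<Rightarrow> ('n, 'k) laurent_ring" where
  "mono_family y F i = Poly_Mapping.single (\<alpha> - to_int_vec (\<beta> i)) (y F i)"

lemma coef_mono [simp]: "coef (mono_family y) = y"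
  by (simp add: coef_def mono_family_def fun_eq_iff)

lemma mono_homogeneous: "mono_family y \<in> cech_homogeneous \<beta> \<alpha>"
  by (simp add: mono_family_def cech_homogeneous_def)

lemma mono_coef:
  assumes "z \<in> cech_homogeneous \<beta> \<alpha>"
  shows "mono_family (coef z) = z"
proof (intro ext)
  fix F :: "'n set" and i
  have k: "Poly_Mapping.keys (z F i) \<subseteq> {\<alpha> - to_int_vec (\<beta> i)}" using assms by (simp add: cech_homogeneous_def)
  show "mono_family (coef z) F i = z F i"
  proof (rule poly_mapping_eqI)
    fix d
    show "Poly_Mapping.lookup (mono_family (coef z) F i) d = Poly_Mapping.lookup (z F i) d"
      using k by (cases "d = \<alpha> - to_int_vec (\<beta> i)") (auto simp: mono_family_def coef_def lookup_single when_def in_keys_iff)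
  qed
qed

lemma coef_add: "coef (z + y) = (\<lambda>F i. coef z F i + coef y F i)"
  by (simp add: coef_def lookup_add fun_eq_iff)

lemma coef_diff: "coef (z - y) = (\<lambda>F i. coef z F i - coef y F i)"
  by (simp add: coef_def lookup_minus fun_eq_iff)

lemma coef_scale: "coef (cech_scale x z) = (\<lambda>F i. x * coef z F i)"
  by (simp add: coef_def lookup_cech_scale fun_eq_iff)

lemma sgn_in_mult_single: "sgn_in k G * p = Poly_Mapping.single 0 (sgn_in k G) * (p :: ('n, 'k) laurent_ring)"
proof -
  have "(-1 :: ('n, 'k) laurent_ring) ^ m = Poly_Mapping.single 0 ((-1) ^ m)" for m
    by (cases "even m") (simp_all add: single_uminus single_one)
  thus ?thesis by (simp add: sgn_in_def)
qed

lemma coef_cech_differential: "coef (cech_differential z) = coboundary (coef z)"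
proof (intro ext)
  fix G :: "'n set" and i
  have "Poly_Mapping.lookup (sgn_in k G * p) d = sgn_in k G * Poly_Mapping.lookup p d" for k and p :: "('n, 'k) laurent_ring" and d
    using lookup_single_mult_add[of 0 "sgn_in k G" p d] by (simp add: sgn_in_mult_single)
  thus "coef (cech_differential z) G i = coboundary (coef z) G i"
    by (simp add: coef_def cech_differential_def coboundary_def lookup_sum)
qed

lemma cech_differential_mono: "cech_differential (mono_family y) = mono_family (coboundary y)"
proof (intro ext)
  fix G :: "'n set" and i
  have "sgn_in k G * Poly_Mapping.single d (x::'k) = Poly_Mapping.single d (sgn_in k G * x)" for k x and d :: "'n \<Rightarrow>\<^sub>0 int"
    by (simp add: sgn_in_mult_single mult_single)
  thus "cech_differential (mono_family y) G i = mono_family (coboundary y) G i"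
    by (simp add: mono_family_def cech_differential_def coboundary_def single_sum)
qed

lemma mono_diff: "mono_family (\<lambda>F i. z F i - y F i) = mono_family z - mono_family y"
  by (simp add: mono_family_def fun_eq_iff single_diff)

lemma coef_cochains_free: "z \<in> cech_cochains (free_module s) p \<Longrightarrow> coef z \<in> cochains V p"
  unfolding cech_cochains_def cochains_def
proof (intro CollectI conjI allI impI)
  fix F :: "'n set" assume "z \<in> {z. (\<forall>F. int (card F) = p \<longrightarrow> z F \<in> localized F (free_module s)) \<and> (\<forall>F. int (card F) \<noteq> p \<longrightarrow> z F = 0)}"
    and "int (card F) = p"
  hence "z F \<in> localized F (free_module s)" by blast
  from localized_free_component[OF this, of _ \<alpha>] show "coef z F \<in> V F"
    by (simp add: V_def coef_def deg_le_outside_neg_support)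
qed (simp add: coef_def fun_eq_iff)

lemma coef_cochains_N: "z \<in> cech_cochains N p \<Longrightarrow> coef z \<in> cochains (\<lambda>F. W F \<alpha>) p"
  unfolding cech_cochains_def cochains_def
proof (intro CollectI conjI allI impI)
  fix F :: "'n set" assume "z \<in> {z. (\<forall>F. int (card F) = p \<longrightarrow> z F \<in> localized F N) \<and> (\<forall>F. int (card F) \<noteq> p \<longrightarrow> z F = 0)}"
    and "int (card F) = p"
  hence "z F \<in> localized F N" by blast
  from localized_N_component[OF this, of \<alpha>] show "coef z F \<in> W F \<alpha>"
    by (simp add: coef_def[abs_def])
qed (simp add: coef_def fun_eq_iff)

lemma mono_cochains_free: "y \<in> cochains V p \<Longrightarrow> mono_family y \<in> cech_cochains (free_module s) p"
  unfolding cech_cochains_def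
proof (intro CollectI conjI allI impI)
  fix F :: "'n set" assume "y \<in> cochains V p" "int (card F) = p"
  hence "y F \<in> V F" by (simp add: cochains_def)
  thus "mono_family y F \<in> localized F (free_module s)"
    unfolding mono_family_def[abs_def]
    by (intro localized_free_monomials) (simp add: V_def deg_le_outside_neg_support)
qed (simp add: mono_family_def fun_eq_iff cochains_def)

lemma mono_cochains_N: "y \<in> cochains (\<lambda>F. W F \<alpha>) p \<Longrightarrow> mono_family y \<in> cech_cochains N p"
  unfolding cech_cochains_def
proof (intro CollectI conjI allI impI)
  fix F :: "'n set" assume "y \<in> cochains (\<lambda>F. W F \<alpha>) p" "int (card F) = p"
  hence "y F \<in> W F \<alpha>" by (simp add: cochains_def)
  thus "mono_family y F \<in> localized F N"
    unfolding mono_family_def[abs_def] by (rule localized_N_monomials)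
qed (simp add: mono_family_def fun_eq_iff cochains_def)

abbreviation "coef_L \<equiv> \<lambda>z. to_L (coef z)"

lemma linear_coef_L: "Vector_Spaces.linear cech_scale L_scale coef_L"
  by (rule Vector_Spaces.linear_iff[THEN iffD2])
     (simp add: vector_space_L_scale vector_space_cech_scale coef_add coef_scale to_L_add to_L_scale)

definition Z :: "int \<Rightarrow> ('n set \<Rightarrow> nat \<Rightarrow> ('n, 'k) laurent_ring) set" where
  "Z p = cech_cocycles (free_module s) N p \<inter> cech_homogeneous \<beta> \<alpha>"

text \<open>For homogeneous families, membership in the localized modules is decided on
  coefficients, and a coboundary consists of relations exactly when its normal form coordinates
  vanish.\<close>

lemma Z_iff: "z \<in> Z p \<longleftrightarrow> z \<in> cech_homogeneous \<beta> \<alpha> \<and> coef z \<in> cochains V p \<and> dL (coef_L z) = 0"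
proof -
  have "z \<in> cech_cocycles (free_module s) N p \<longleftrightarrow> coef z \<in> cochains V p \<and> dL (coef_L z) = 0"
    if z: "z \<in> cech_homogeneous \<beta> \<alpha>"
  proof -
    have 1: "z \<in> cech_cochains (free_module s) p \<longleftrightarrow> coef z \<in> cochains V p"
      using coef_cochains_free[of z p] mono_cochains_free[of "coef z" p] mono_coef[OF z] by auto
    have "cech_differential z = mono_family (coboundary (coef z))"
      using cech_differential_mono[of "coef z"] mono_coef[OF z] by simp
    hence 2: "cech_differential z \<in> cech_cochains N (p + 1) \<longleftrightarrow> coboundary (coef z) \<in> cochains (\<lambda>F. W F \<alpha>) (p + 1)"
      using mono_cochains_N[of "coboundary (coef z)" "p + 1"] coef_cochains_N[of "cech_differential z" "p + 1"] by auto
    show ?thesis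
      unfolding cech_cocycles_def mem_Collect_eq 1 2
      using dL_to_L[of "coef z" p] to_L_eq_0_iff[OF coboundary_V, of "coef z" p] by auto
  qed
  thus ?thesis by (auto simp: Z_def)
qed

lemma subspace_Z: "module.subspace cech_scale (Z p)"
proof -
  interpret Vector_Spaces.linear cech_scale L_scale coef_L by (rule linear_coef_L)
  interpret d: Vector_Spaces.linear L_scale L_scale dL by (rule linear_dL)
  have hom: "z \<in> cech_homogeneous \<beta> \<alpha> \<longleftrightarrow> (\<forall>F i d. d \<noteq> \<alpha> - to_int_vec (\<beta> i) \<longrightarrow> Poly_Mapping.lookup (z F i) d = 0)"
    for z :: "'n set \<Rightarrow> nat \<Rightarrow> ('n, 'k) laurent_ring"
    unfolding cech_homogeneous_def by (auto simp: in_keys_iff subset_iff)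
  show ?thesis
  proof (rule vs1.subspaceI)
    have c: "coef 0 = (\<lambda>F i. 0)" by (simp add: coef_def fun_eq_iff)
    have "coef 0 \<in> cochains V p" unfolding c by (simp add: cochains_def V_zero zero_fun_def)
    thus "0 \<in> Z p" unfolding Z_iff hom zero d.zero by simp
  next
    fix x y assume "x \<in> Z p" "y \<in> Z p"
    thus "x + y \<in> Z p" unfolding Z_iff hom add d.add
      by (auto simp: coef_add lookup_add cochains_def intro: V_add)
  next
    fix k x assume "x \<in> Z p"
    thus "cech_scale k x \<in> Z p" unfolding Z_iff hom scale d.scale
      by (auto simp: coef_scale lookup_cech_scale cochains_def intro: V_scale)
  qed
qed

text \<open>\<open>coef_L\<close> maps homogeneous cocycles onto the kernel of \<open>dL\<close> and
  detects coboundaries, so \<open>quotient_dim_image\<close> applies.\<close>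

lemma local_cohomology_dim_eq:
  "local_cohomology_dim (free_module s) N \<beta> p \<alpha> = quotient_dim L_scale {f \<in> L_sp p. dL f = 0} (dL ` L_sp (p - 1))"
  unfolding local_cohomology_dim_def Z_def[symmetric]
proof (rule quotient_dim_image[OF linear_coef_L subspace_Z])
  show "coef_L ` Z p = {f \<in> L_sp p. dL f = 0}"
  proof (intro equalityI subsetI)
    fix f assume "f \<in> {f \<in> L_sp p. dL f = 0}"
    hence f: "f \<in> L_sp p" "dL f = 0" by auto
    have eq: "coef_L (mono_family (from_L f)) = f" by (simp add: to_L_from_L[OF f(1)])
    hence "mono_family (from_L f) \<in> Z p"
      unfolding Z_iff using f from_L_cochains[OF f(1)] by (simp add: mono_homogeneous)
    with eq show "f \<in> coef_L ` Z p" by (metis imageI)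
  qed (auto simp: Z_iff to_L_cochains)
  show "coef_L z \<in> dL ` L_sp (p - 1) \<longleftrightarrow> z \<in> cech_coboundaries (free_module s) N p" if z: "z \<in> Z p" for z
  proof
    assume "coef_L z \<in> dL ` L_sp (p - 1)"
    then obtain g where g: "g \<in> L_sp (p - 1)" "coef_L z = dL g" by blast
    \<comment> \<open>A primitive in coordinates is lifted through \<open>from_L\<close> and then
      spread to a homogeneous family of Laurent monomials.\<close>
    define y where "y = from_L g"
    have y: "y \<in> cochains V (p - 1)" unfolding y_def by (rule from_L_cochains[OF g(1)])
    have "to_L (coef z) = to_L (coboundary y)" using g(2) by (simp add: dL_def y_def)
    moreover have "coboundary y \<in> cochains V p" using coboundary_V[OF y] by simp
    ultimately have "(\<lambda>F i. coef z F i - coboundary y F i) \<in> cochains (\<lambda>F. W F \<alpha>) p"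
      using z by (subst (asm) to_L_eq_iff) (auto simp: Z_iff)
    from mono_cochains_N[OF this] have "z - cech_differential (mono_family y) \<in> cech_cochains N p"
      using z by (simp add: mono_diff cech_differential_mono mono_coef Z_iff)
    thus "z \<in> cech_coboundaries (free_module s) N p"
      using mono_cochains_free[OF y] by (auto simp: cech_coboundaries_def)
  next
    assume "z \<in> cech_coboundaries (free_module s) N p"
    then obtain y where y: "y \<in> cech_cochains (free_module s) (p - 1)" "z - cech_differential y \<in> cech_cochains N p"
      by (auto simp: cech_coboundaries_def)
    \<comment> \<open>The primitive \<open>y\<close> need not be homogeneous; passing to
      \<open>coef y\<close> keeps its component of degree \<alpha>, which suffices because
      \<open>coef\<close> commutes with the differentials.\<close>
    have c: "coef y \<in> cochains V (p - 1)" by (rule coef_cochains_free[OF y(1)])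
    have "coboundary (coef y) \<in> cochains V p" using coboundary_V[OF c] by simp
    moreover have "(\<lambda>F i. coef z F i - coboundary (coef y) F i) \<in> cochains (\<lambda>F. W F \<alpha>) p"
      using coef_cochains_N[OF y(2)] by (simp add: coef_diff coef_cech_differential)
    ultimately have "coef_L z = to_L (coboundary (coef y))"
      using z by (subst to_L_eq_iff) (auto simp: Z_iff)
    also have "\<dots> = dL (coef_L y)" by (simp add: dL_to_L[OF c])
    finally show "coef_L z \<in> dL ` L_sp (p - 1)" using to_L_cochains[OF c] by blast
  qed
  have "(0 :: 'n set \<Rightarrow> nat \<Rightarrow> ('n, 'k) laurent_ring) \<in> cech_cochains (free_module s) q" for q
    using mono_cochains_free[of "\<lambda>F i. 0" q]
    by (simp add: mono_family_def[abs_def] cochains_def V_zero zero_fun_def)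
  moreover have "0 \<in> cech_cochains N p"
    using mono_cochains_N[of "\<lambda>F i. 0" p] W_zero
    by (simp add: mono_family_def[abs_def] cochains_def zero_fun_def)
  moreover have "cech_differential 0 = (0 :: 'n set \<Rightarrow> nat \<Rightarrow> ('n, 'k) laurent_ring)"
    by (simp add: cech_differential_def fun_eq_iff)
  ultimately show "0 \<in> cech_coboundaries (free_module s) N p"
    unfolding cech_coboundaries_def by (auto intro!: bexI[of _ 0])
qed

section \<open>The combinatorial complex and its cohomology\<close>

lemma cochain_complex_L: "cochain_complex L_scale (L_space s leq N \<beta> \<alpha>) (L_diff leq N \<beta> \<alpha>)"
  unfolding cochain_complex_def
proof (intro conjI allI ballI)
  interpret vector_space "L_scale :: 'k \<Rightarrow> (nat \<times> 'n set \<Rightarrow>\<^sub>0 'k) \<Rightarrow> _" by (rule vector_space_L_scale)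
  show "Vector_Spaces.linear L_scale L_scale (L_diff leq N \<beta> \<alpha>)" by (rule linear_L_diff)
  show "subspace (L_space s leq N \<beta> \<alpha> r)" for r
  proof -
    have iff: "f \<in> L_sp p \<longleftrightarrow> (\<forall>b. b \<notin> L_idx p \<longrightarrow> Poly_Mapping.lookup f b = 0)" for f p
      unfolding L_sp_def by (auto simp: in_keys_iff subset_iff)
    show ?thesis unfolding L_space_eq by (rule subspaceI) (simp_all add: iff lookup_add)
  qed
  fix r f assume "f \<in> L_space s leq N \<beta> \<alpha> r"
  hence f: "f \<in> L_sp (r + int (card (neg_support \<beta> \<alpha> 0)) + 1)" by (simp add: L_space_eq)
  show "L_diff leq N \<beta> \<alpha> f \<in> L_space s leq N \<beta> \<alpha> (r + 1)"
    using dL_in_L_sp[OF f] by (simp add: L_diff_eq_dL[OF f] L_space_eq algebra_simps)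
  show "L_diff leq N \<beta> \<alpha> (L_diff leq N \<beta> \<alpha> f) = 0"
    using L_diff_eq_dL[OF dL_in_L_sp[OF f]] dL_dL[OF f] by (simp add: L_diff_eq_dL[OF f])
qed

text \<open>By \<open>L_space_eq\<close> the stated shift turns the cochain spaces in the relevant
  two degrees into \<open>L_sp p\<close> and \<open>L_sp (p - 1)\<close>, on which
  \<open>L_diff\<close> is \<open>dL\<close>.\<close>

lemma local_cohomology_dim_eq_cohomology_dim:
  "local_cohomology_dim (free_module s) N \<beta> p \<alpha> =
     cohomology_dim L_scale (L_space s leq N \<beta> \<alpha>) (L_diff leq N \<beta> \<alpha>) (p - int (card (neg_support \<beta> \<alpha> 0)) - 1)"
proof -
  have "{f \<in> L_sp p. L_diff leq N \<beta> \<alpha> f = 0} = {f \<in> L_sp p. dL f = 0}"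
    using L_diff_eq_dL by auto
  moreover have "L_diff leq N \<beta> \<alpha> ` L_sp (p - 1) = dL ` L_sp (p - 1)"
    using L_diff_eq_dL by (intro image_cong) auto
  ultimately show ?thesis by (simp add: local_cohomology_dim_eq cohomology_dim_def L_space_eq)
qed

end

theorem theorem5p4:
  fixes c :: "nat \<Rightarrow> nat \<Rightarrow> 'k::field_char_0"
    and a :: "nat \<Rightarrow> nat \<Rightarrow> ('n::{finite,linorder} \<Rightarrow>\<^sub>0 nat)"
    and \<gamma> \<beta> :: "nat \<Rightarrow> ('n \<Rightarrow>\<^sub>0 nat)"
    and leq :: "('n \<Rightarrow>\<^sub>0 nat) \<Rightarrow> ('n \<Rightarrow>\<^sub>0 nat) \<Rightarrow> bool"
    and \<alpha> :: "'n \<Rightarrow>\<^sub>0 int"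
    and s l :: nat
  assumes "0 < s"
    and "multigraded (monomial_matrix s l c a)"
    and "squarefree_solution s l c a \<gamma> \<beta>"
    and "monomial_order leq"
  shows
    "let N = column_module (monomial_matrix s l c a);
         L = L_space s leq N \<beta> \<alpha>;
         d = L_diff leq N \<beta> \<alpha>
     in cochain_complex L_scale L d \<and>
        (\<forall>i::int. local_cohomology_dim (free_module s) N \<beta> i \<alpha> =
           cohomology_dim L_scale L d (i - int (card (neg_support \<beta> \<alpha> 0)) - 1))"
proof -
  interpret squarefree_presentation_degree s l c a \<gamma> \<beta> leq \<alpha>
    by standard (fact assms)+
  show ?thesis
    unfolding Let_def using cochain_complex_L local_cohomology_dim_eq_cohomology_dim by blast
qed

end
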